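(* Let $0<p\leq 1/2$ and let $f\in H_{p}(G_m)$. For $n\in\mathbb{N}_+$ let $N=N(n)$ denote the integer with $M_{N}<n\leq M_{N+1}$. Suppose that \[ \omega\left(\frac{1}{M_{N}},f\right)_{H_{p}}=o\left(\frac{1}{M_{N}^{1/p-2}\,N^{2\left[1/2+p\right]}}\right)\quad\text{as } N\rightarrow\infty , \] where $\left[1/2+p\right]$ denotes the integer part of $1/2+p$. Then \[ \left\Vert \sigma_{n}f-f\right\Vert_{p}\rightarrow 0\quad\text{as } n\rightarrow\infty . \]
   Context: Let $m=(m_0,m_1,\dots)$ be a bounded sequence of integers with $m_k\ge 2$ (bounded Vilenkin group). $G_m$ is the complete direct product of the cyclic groups $Z_{m_k}=\{0,\dots,m_k-1\}$ with the product topology and product Haar measure $\mu$ (each point of $Z_{m_k}$ has mass $1/m_k$), so $\mu(G_m)=1$. Put $M_0=1$, $M_{k+1}=m_kM_k$. Every $n\in\mathbb{N}$ is uniquely $n=\sum_j n_jM_j$ with $n_j\in Z_{m_j}$. The generalized Rademacher functions are $r_k(x)=\exp(2\pi\iota x_k/m_k)$ for $x=(x_0,x_1,\dots)\in G_m$, and the Vilenkin system is $\psi_n=\prod_k r_k^{n_k}$. For $x\in G_m$, $I_n(x)=\{y\in G_m: y_j=x_j,\ j<n\}$, and $\digamma_n$ is the $\sigma$-algebra generated by $\{I_n(x):x\in G_m\}$. For a martingale $f=(f^{(n)})$ with respect to $(\digamma_n)$, the maximal function is $f^*=\sup_n|f^{(n)}|$ and for $0<p<\infty$, $H_p(G_m)$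 is the space of martingales with $\|f\|_{H_p}:=\|f^*\|_p<\infty$, where $\|g\|_p=(\int_{G_m}|g|^pd\mu)^{1/p}$. The Fourier coefficients of a martingale are $\widehat f(i)=\lim_{k\to\infty}\int_{G_m}f^{(k)}\overline{\psi_i}\,d\mu$, the partial sums are $S_nf=\sum_{k=0}^{n-1}\widehat f(k)\psi_k$ ($S_0f=0$), and the Fejér means are $\sigma_nf=\frac1n\sum_{k=1}^nS_kf$. The modulus of continuity in $H_p$ is $\omega(1/M_n,f)_{H_p}:=\|f-S_{M_n}f\|_{H_p}$. *)

theory Defs
  imports "HOL-Probability.Probability" "HOL-Library.Landau_Symbols"
begin

definition vil_space :: "(nat \<Rightarrow> nat) \<Rightarrow> (nat \<Rightarrow> nat) set" where
  "vil_space m = {x. \<forall>k. x k < m k}"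

definition vil_mu :: "(nat \<Rightarrow> nat) \<Rightarrow> (nat \<Rightarrow> nat) measure" where
  "vil_mu m = (\<Pi>\<^sub>M k\<in>(UNIV::nat set). uniform_count_measure {..<m k})"

definition M :: "(nat \<Rightarrow> nat) \<Rightarrow> nat \<Rightarrow> nat" where
  "M m j = (\<Prod>i<j. m i)"

definition digit :: "(nat \<Rightarrow> nat) \<Rightarrow> nat \<Rightarrow> nat \<Rightarrow> nat" where
  "digit m n j = (n div M m j) mod m j"

definition rad :: "(nat \<Rightarrow> nat) \<Rightarrow> nat \<Rightarrow> (nat \<Rightarrow> nat) \<Rightarrow> complex" where
  "rad m k x = cis (2 * pi * real (x k) / real (m k))"

text \<open>Vilenkin system; digits of n of index >= n vanish since M_k >= 2^k > n.\<close>
definition psi :: "(nat \<Rightarrow> nat) \<Rightarrow> nat \<Rightarrow> (nat \<Rightarrow> nat) \<Rightarrow> complex" where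
  "psi m n x = (\<Prod>k<n. rad m k x ^ digit m n k)"

definition I_n :: "(nat \<Rightarrow> nat) \<Rightarrow> nat \<Rightarrow> (nat \<Rightarrow> nat) \<Rightarrow> (nat \<Rightarrow> nat) set" where
  "I_n m n x = {y \<in> vil_space m. \<forall>j<n. y j = x j}"

text \<open>Martingales w.r.t. (F_n): f n is F_n-measurable (depends only on the first n
  coordinates, F_n being generated by the finitely many atoms I_n(x)) and the
  martingale property: integrals of f (n+1) and f n agree on each atom of F_n.\<close>
definition vil_martingale :: "(nat \<Rightarrow> nat) \<Rightarrow> (nat \<Rightarrow> (nat \<Rightarrow> nat) \<Rightarrow> complex) \<Rightarrow> bool" where
  "vil_martingale m f \<longleftrightarrow>
     (\<forall>n x y. x \<in> vil_space m \<and> y \<in> vil_space m \<and> (\<forall>j<n. x j = y j) \<longrightarrow> f n x = f n y) \<and>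
     (\<forall>n x. x \<in> vil_space m \<longrightarrow>
        (\<integral>y\<in>I_n m n x. f (Suc n) y \<partial>vil_mu m) = (\<integral>y\<in>I_n m n x. f n y \<partial>vil_mu m))"

text \<open>int (f^* ^ p) with f^* = sup_n |f^(n)|  (note (sup |.|)^p = sup |.|^p).\<close>
definition maxfun_int :: "(nat \<Rightarrow> nat) \<Rightarrow> real \<Rightarrow> (nat \<Rightarrow> (nat \<Rightarrow> nat) \<Rightarrow> complex) \<Rightarrow> ennreal" where
  "maxfun_int m p f = (\<integral>\<^sup>+ x. (SUP n. ennreal (cmod (f n x) powr p)) \<partial>vil_mu m)"

definition in_Hp :: "(nat \<Rightarrow> nat) \<Rightarrow> real \<Rightarrow> (nat \<Rightarrow> (nat \<Rightarrow> nat) \<Rightarrow> complex) \<Rightarrow> bool" where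
  "in_Hp m p f \<longleftrightarrow> vil_martingale m f \<and> maxfun_int m p f < \<infinity>"

definition Hp_norm :: "(nat \<Rightarrow> nat) \<Rightarrow> real \<Rightarrow> (nat \<Rightarrow> (nat \<Rightarrow> nat) \<Rightarrow> complex) \<Rightarrow> real" where
  "Hp_norm m p f = enn2real (maxfun_int m p f) powr (1 / p)"

definition fourier_coeff :: "(nat \<Rightarrow> nat) \<Rightarrow> (nat \<Rightarrow> (nat \<Rightarrow> nat) \<Rightarrow> complex) \<Rightarrow> nat \<Rightarrow> complex" where
  "fourier_coeff m f i = lim (\<lambda>k. \<integral>x. f k x * cnj (psi m i x) \<partial>vil_mu m)"

definition partial_sum :: "(nat \<Rightarrow> nat) \<Rightarrow> (nat \<Rightarrow> (nat \<Rightarrow> nat) \<Rightarrow> complex) \<Rightarrow> nat \<Rightarrow> (nat \<Rightarrow> nat) \<Rightarrow> complex" where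
  "partial_sum m f n x = (\<Sum>k<n. fourier_coeff m f k * psi m k x)"

definition fejer :: "(nat \<Rightarrow> nat) \<Rightarrow> (nat \<Rightarrow> (nat \<Rightarrow> nat) \<Rightarrow> complex) \<Rightarrow> nat \<Rightarrow> (nat \<Rightarrow> nat) \<Rightarrow> complex" where
  "fejer m f n x = (\<Sum>k\<in>{1..n}. partial_sum m f k x) / of_nat n"

text \<open>Conditional expectation E(g | F_n) (F_n is generated by the atoms I_n(x)).\<close>
definition condexp_n :: "(nat \<Rightarrow> nat) \<Rightarrow> nat \<Rightarrow> ((nat \<Rightarrow> nat) \<Rightarrow> complex) \<Rightarrow> (nat \<Rightarrow> nat) \<Rightarrow> complex" where
  "condexp_n m n g x = (\<integral>y\<in>I_n m n x. g y \<partial>vil_mu m) / of_real (measure (vil_mu m) (I_n m n x))"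

text \<open>Modulus of continuity omega(1/M_n, f)_{H_p} = || f - S_{M_n} f ||_{H_p}, where
  S_{M_n} f is viewed as the martingale (E(S_{M_n} f | F_k))_k.\<close>
definition modulus :: "(nat \<Rightarrow> nat) \<Rightarrow> real \<Rightarrow> (nat \<Rightarrow> (nat \<Rightarrow> nat) \<Rightarrow> complex) \<Rightarrow> nat \<Rightarrow> real" where
  "modulus m p f n =
     Hp_norm m p (\<lambda>k x. f k x - condexp_n m k (partial_sum m f (M m n)) x)"

end

theory Submission
  imports Defs
begin

text \<open>
  Let \<open>f_N\<close> be the terms of the martingale and \<open>d = f_(N+1) - f_N\<close>. For \<open>M_N < n \<le> M_(N+1)\<close> only
  the martingale up to level \<open>N + 1\<close> enters \<open>\<sigma>_n f\<close>, and
  \<open>\<sigma>_n f - f_N = \<sigma>_n d + (M_N / n) (\<sigma>_(M_N) f_N - f_N)\<close>.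
  No atomic decomposition is needed: a function that is constant on the atoms of level \<open>J\<close> is a
  combination of indicators of these atoms, so by subadditivity of \<open>t \<mapsto> t powr p\<close> the action of
  \<open>\<sigma>_n\<close> on such functions is controlled by the \<open>L_p\<close> size of the Fejer kernel alone. The kernel
  splits along the digits of \<open>n\<close>, which gives
  \<open>\<integral>|\<sigma>_n h|^p \<le> C M_J^(1-2p) (\<Sum>A\<le>J. M_A^(2p-1)) \<integral>|h|^p\<close> for \<open>n\<close> comparable to \<open>M_J\<close>. The sum is
  bounded for \<open>p < 1/2\<close> and equals \<open>J + 1\<close> for \<open>p = 1/2\<close>, exactly the loss that the hypothesis
  on the modulus of continuity compensates. The integral of the \<open>p\<close>-th power of
  \<open>\<sigma>_(M_N) f_N - f_N\<close> satisfies a recurrence in \<open>N\<close> with contraction factor \<open>2^(-p)\<close> and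
  vanishing inhomogeneity, so it tends to zero. The limit \<open>g\<close> is the almost everywhere limit of
  the martingale.
\<close>

subsection \<open>Powers with exponent at most one\<close>

text \<open>With \<open>s = a + b\<close>, each of \<open>a / s\<close> and \<open>b / s\<close>
  lies between 0 and 1 and is therefore at most its own \<open>p\<close>-th power. The two fractions
  add up to 1, so multiplying by \<open>s powr p\<close> gives the claim.\<close>

lemma powr_add_le_powr_add_powr:
  fixes a b p :: real
  assumes "0 \<le> a" "0 \<le> b" "0 < p" "p \<le> 1"
  shows "(a + b) powr p \<le> a powr p + b powr p"
proof (cases "a + b = 0")
  case True
  then show ?thesis by simp
next
  case False
  define s where "s = a + b"
  have s: "0 < s" using False assms s_def by simp
  have *: "c / s * s powr p \<le> c powr p" if "0 \<le> c" "c \<le> s" for c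
  proof -
    have "c / s \<le> (c / s) powr p"
    proof (cases "c = 0")
      case False
      then have "(c / s) powr 1 \<le> (c / s) powr p"
        using that s assms by (intro powr_mono') auto
      then show ?thesis using that s by simp
    qed simp
    then have "c / s * s powr p \<le> (c / s) powr p * s powr p"
      by (intro mult_right_mono) auto
    also have "\<dots> = c powr p" using that s by (simp add: powr_divide)
    finally show ?thesis .
  qed
  have "a / s + b / s = 1" using s by (simp add: s_def add_divide_distrib [symmetric])
  then have "s powr p = a / s * s powr p + b / s * s powr p"
    by (metis distrib_right mult_1)
  also have "\<dots> \<le> a powr p + b powr p"
    using assms by (intro add_mono *) (auto simp: s_def)
  finally show ?thesis by (simp add: s_def)
qed

lemma powr_sum_le_sum_powr:
  fixes h :: "'a \<Rightarrow> real"
  assumes "finite A" "\<And>i. i \<in> A \<Longrightarrow> 0 \<le> h i" "0 < p" "p \<le> 1"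
  shows "(\<Sum>i\<in>A. h i) powr p \<le> (\<Sum>i\<in>A. h i powr p)"
  using assms(1,2)
proof (induction A rule: finite_induct)
  case (insert a A)
  have "(\<Sum>i\<in>insert a A. h i) powr p \<le> h a powr p + (\<Sum>i\<in>A. h i) powr p"
    using insert assms by (simp add: powr_add_le_powr_add_powr sum_nonneg)
  also have "\<dots> \<le> h a powr p + (\<Sum>i\<in>A. h i powr p)"
    using insert by simp
  finally show ?case using insert by simp
qed simp

lemma norm_add_powr_le:
  fixes a b :: "'a::real_normed_vector"
  assumes "0 < p" "p \<le> 1"
  shows "norm (a + b) powr p \<le> norm a powr p + norm b powr p"
proof -
  have "norm (a + b) powr p \<le> (norm a + norm b) powr p"
    using assms by (intro powr_mono2) (auto simp: norm_triangle_ineq)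
  also have "\<dots> \<le> norm a powr p + norm b powr p"
    using assms by (intro powr_add_le_powr_add_powr) auto
  finally show ?thesis .
qed

text \<open>Serves the recurrence for \<open>fejer_defect\<close>, whose contraction factor is
  \<open>(1 / 2) powr p\<close>.\<close>

lemma tendsto_zero_of_contraction_recurrence:
  fixes q e :: "nat \<Rightarrow> real"
  assumes q: "\<And>n. 0 \<le> q n" and rec: "\<And>n. q (Suc n) \<le> e n + c * q n"
    and c: "0 \<le> c" "c < 1" and e: "e \<longlonglongrightarrow> 0"
  shows "q \<longlonglongrightarrow> 0"
proof (rule LIMSEQ_I)
  fix r :: real assume r: "0 < r"
  \<comment> \<open>Chosen so that \<open>r / 2\<close> is the fixed point of
    \<open>t \<mapsto> s + c * t\<close>: once the errors are below \<open>s\<close>, the sequence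
    stays below \<open>r / 2\<close> plus a geometrically decaying term.\<close>
  define s where "s = r / 2 * (1 - c)"
  have s: "0 < s" using r c by (simp add: s_def)
  obtain n0 where n0: "\<And>n. n \<ge> n0 \<Longrightarrow> \<bar>e n\<bar> < s"
    using LIMSEQ_D[OF e s] by auto
  have bound: "q (n0 + k) \<le> r / 2 + c ^ k * q n0" for k
  proof (induction k)
    case (Suc k)
    have "q (n0 + Suc k) \<le> e (n0 + k) + c * q (n0 + k)" using rec[of "n0 + k"] by simp
    also have "\<dots> \<le> s + c * (r / 2 + c ^ k * q n0)"
      using n0[of "n0 + k"] Suc c by (intro add_mono mult_left_mono) auto
    also have "\<dots> = r / 2 + c ^ Suc k * q n0"
      by (simp add: s_def field_simps)
    finally show ?case .
  qed (use r in simp)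
  have "(\<lambda>k. c ^ k * q n0) \<longlonglongrightarrow> 0"
    using c by (intro tendsto_mult_left_zero LIMSEQ_power_zero) auto
  then obtain k0 where k0: "\<And>k. k \<ge> k0 \<Longrightarrow> \<bar>c ^ k * q n0\<bar> < r / 2"
    using LIMSEQ_D[of "\<lambda>k. c ^ k * q n0" 0 "r / 2"] r by auto
  have "norm (q n - 0) < r" if "n \<ge> n0 + k0" for n
    using bound[of "n - n0"] k0[of "n - n0"] q[of n] that by force
  then show "\<exists>n0. \<forall>n\<ge>n0. norm (q n - 0) < r" by blast
qed

lemma sum_lessThan_mult_nested:
  fixes h :: "nat \<Rightarrow> 'a::comm_monoid_add"
  shows "(\<Sum>i<b * k. h i) = (\<Sum>c<b. \<Sum>s<k. h (c * k + s))"
proof -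
  have "(\<Sum>i<b * k. h i) = (\<Sum>c<b. sum h {c * k..<c * k + k})"
    by (rule sum.nat_group [symmetric])
  also have "\<dots> = (\<Sum>c<b. \<Sum>s<k. h (c * k + s))"
  proof (rule sum.cong [OF refl])
    fix c
    show "sum h {c * k..<c * k + k} = (\<Sum>s<k. h (c * k + s))"
      using sum.shift_bounds_nat_ivl[of h 0 "c * k" k]
      by (simp add: add.commute lessThan_atLeast0)
  qed
  finally show ?thesis .
qed

subsection \<open>Digits and kernels\<close>

locale bounded_vilenkin =
  fixes m :: "nat \<Rightarrow> nat" and B :: nat
  assumes m_ge: "\<And>k. 2 \<le> m k" and m_le: "\<And>k. m k \<le> B"
begin

lemma m_pos: "0 < m k"
  using m_ge[of k] by simp

lemma M_0 [simp]: "M m 0 = 1"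
  by (simp add: M_def)

lemma M_Suc: "M m (Suc A) = m A * M m A"
  by (simp add: M_def)

lemma M_pos: "0 < M m A"
  using m_pos by (simp add: M_def prod_pos)

lemma M_dvd: "j \<le> A \<Longrightarrow> M m j dvd M m A"
  by (simp add: M_def prod_dvd_prod_subset)

lemma M_mono: "j \<le> A \<Longrightarrow> M m j \<le> M m A"
  using dvd_imp_le[OF M_dvd M_pos] .

lemma less_M: "A < M m A"
proof (induction A)
  case (Suc A)
  have "2 * M m A \<le> M m (Suc A)" using m_ge[of A] by (simp add: M_Suc)
  with Suc show ?case by linarith
qed simp

lemma digit_less: "digit m n j < m j"
  using m_pos by (simp add: digit_def)

lemma digit_in_space: "digit m n \<in> vil_space m"
  by (simp add: vil_space_def digit_less)

lemma digit_low:
  assumes "j < A"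
  shows "digit m (b * M m A + s) j = digit m s j"
proof -
  \<comment> \<open>\<open>M m A\<close> contains the factor \<open>m j * M m j\<close>, so adding
    \<open>b * M m A\<close> changes the quotient of the division by \<open>M m j\<close> only by a
    multiple of \<open>m j\<close>.\<close>
  obtain q where "M m A = M m (Suc j) * q"
    using M_dvd[of "Suc j" A] assms by auto
  then have *: "b * M m A + s = (b * q * m j) * M m j + s" by (simp add: M_Suc)
  have "(b * M m A + s) div M m j = b * q * m j + s div M m j"
    unfolding * using M_pos[of j] by (intro div_mult_self3) simp
  then show ?thesis by (simp add: digit_def)
qed

lemma digit_top:
  assumes "s < M m A" "b < m A"
  shows "digit m (b * M m A + s) A = b"
  using assms by (simp add: digit_def)

lemma digit_high:
  assumes "n < M m A" "A \<le> j"
  shows "digit m n j = 0"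
  using assms M_mono[of A j] by (simp add: digit_def)

lemma M_split:
  assumes "n < M m (Suc A)"
  obtains b s where "n = b * M m A + s" "s < M m A" "b < m A"
proof
  show "n = n div M m A * M m A + n mod M m A" by (rule div_mult_mod_eq [symmetric])
  show "n mod M m A < M m A" using M_pos by simp
  show "n div M m A < m A" using assms by (simp add: M_Suc less_mult_imp_div_less)
qed

lemma ex_digits:
  assumes "x \<in> vil_space m"
  shows "\<exists>n<M m A. \<forall>j<A. digit m n j = x j"
proof (induction A)
  case (Suc A)
  then obtain n where n: "n < M m A" "\<forall>j<A. digit m n j = x j" by blast
  have x: "x A < m A" using assms by (simp add: vil_space_def)
  have "x A * M m A + n < (x A + 1) * M m A" using n by simp
  also have "\<dots> \<le> M m (Suc A)" using x unfolding M_Suc by (intro mult_right_mono) auto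
  finally have "x A * M m A + n < M m (Suc A)" .
  moreover have "\<forall>j<Suc A. digit m (x A * M m A + n) j = x j"
    using n x by (auto simp: less_Suc_eq digit_low digit_top)
  ultimately show ?case by blast
qed simp

lemma digits_unique:
  assumes "n < M m A" "n' < M m A" "\<forall>j<A. digit m n j = digit m n' j"
  shows "n = n'"
  using assms
proof (induction A arbitrary: n n')
  case (Suc A)
  obtain b s where n: "n = b * M m A + s" "s < M m A" "b < m A"
    using M_split[OF Suc.prems(1)] .
  obtain b' s' where n': "n' = b' * M m A + s'" "s' < M m A" "b' < m A"
    using M_split[OF Suc.prems(2)] .
  have "b = b'" using Suc.prems(3) n n' digit_top by (metis lessI)
  moreover have "s = s'" using Suc.prems(3) n n'
    by (intro Suc.IH) (auto simp: digit_low less_Suc_eq)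
  ultimately show ?case using n n' by simp
qed simp

section \<open>Characters and their factorisation along digits\<close>

lemma psi_eq_prod:
  assumes "n < M m A"
  shows "psi m n x = (\<Prod>k<A. rad m k x ^ digit m n k)"
proof -
  \<comment> \<open>Either of \<open>n\<close> and \<open>A\<close> may be the larger one, so both
    products are compared with the product up to \<open>max n A\<close>; the added factors have
    digit 0.\<close>
  have "psi m n x = (\<Prod>k<max n A. rad m k x ^ digit m n k)"
    unfolding psi_def using less_M[of n]
    by (intro prod.mono_neutral_left) (auto simp: digit_high)
  also have "\<dots> = (\<Prod>k<A. rad m k x ^ digit m n k)"
    using assms by (intro prod.mono_neutral_right) (auto simp: digit_high)
  finally show ?thesis .
qed

lemma psi_split:
  assumes "s < M m A" "b < m A"
  shows "psi m (b * M m A + s) x = rad m A x ^ b * psi m s x"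
proof -
  have "b * M m A + s < (b + 1) * M m A" using assms by simp
  also have "\<dots> \<le> M m (Suc A)" unfolding M_Suc using assms by (intro mult_right_mono) auto
  finally have "b * M m A + s < M m (Suc A)" .
  then have "psi m (b * M m A + s) x = (\<Prod>k<Suc A. rad m k x ^ digit m (b * M m A + s) k)"
    by (rule psi_eq_prod)
  then show ?thesis using assms by (simp add: digit_low digit_top psi_eq_prod[of s A])
qed

lemma psi_cong:
  assumes "i < M m A" "\<forall>j<A. x j = y j"
  shows "psi m i x = psi m i y"
  using assms by (simp add: psi_eq_prod rad_def)

text \<open>This is the Dirichlet kernel at the group difference of \<open>x\<close> and
  \<open>y\<close>, since \<open>psi m i x * cnj (psi m i y)\<close> is the character at that
  difference. Keeping two variables replaces subtraction in the group.\<close>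

definition dirichlet_kernel :: "nat \<Rightarrow> (nat \<Rightarrow> nat) \<Rightarrow> (nat \<Rightarrow> nat) \<Rightarrow> complex" where
  "dirichlet_kernel n x y = (\<Sum>i<n. psi m i x * cnj (psi m i y))"

text \<open>This is \<open>n\<close> times the usual Fejer kernel.\<close>

definition fejer_kernel :: "nat \<Rightarrow> (nat \<Rightarrow> nat) \<Rightarrow> (nat \<Rightarrow> nat) \<Rightarrow> complex" where
  "fejer_kernel n x y = (\<Sum>k=1..n. dirichlet_kernel k x y)"

text \<open>The value of the Rademacher function of index \<open>A\<close> at the group difference
  of \<open>x\<close> and \<open>y\<close>.\<close>

definition ratio :: "nat \<Rightarrow> (nat \<Rightarrow> nat) \<Rightarrow> (nat \<Rightarrow> nat) \<Rightarrow> complex" where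
  "ratio A x y = rad m A x * cnj (rad m A y)"

definition ratio_sum :: "nat \<Rightarrow> nat \<Rightarrow> (nat \<Rightarrow> nat) \<Rightarrow> (nat \<Rightarrow> nat) \<Rightarrow> complex" where
  "ratio_sum b A x y = (\<Sum>c<b. ratio A x y ^ c)"

lemma norm_ratio [simp]: "norm (ratio A x y) = 1"
  by (simp add: ratio_def rad_def norm_mult)

lemma norm_ratio_sum_le: "norm (ratio_sum b A x y) \<le> real b"
proof -
  have "norm (ratio_sum b A x y) \<le> (\<Sum>c<b. norm (ratio A x y ^ c))"
    unfolding ratio_sum_def by (rule norm_sum)
  then show ?thesis by (simp add: norm_power)
qed

text \<open>Orthogonality on a cyclic group: the ratio is an \<open>m A\<close>-th root of unity,
  and it equals 1 only for equal coordinates because these differ by less than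
  \<open>m A\<close>.\<close>

lemma ratio_sum_full:
  assumes "x \<in> vil_space m" "y \<in> vil_space m"
  shows "ratio_sum (m A) A x y = (if x A = y A then of_nat (m A) else 0)"
proof (cases "x A = y A")
  case True
  then have "ratio A x y = 1"
    by (simp add: ratio_def rad_def cis_cnj cis_mult)
  then show ?thesis using True by (simp add: ratio_sum_def)
next
  case False
  define t where "t = (real (x A) - real (y A)) / real (m A)"
  have eq: "ratio A x y = cis (2 * pi * t)"
    using m_pos[of A] by (simp add: ratio_def rad_def cis_cnj cis_mult t_def diff_divide_distrib right_diff_distrib)
  have "ratio A x y \<noteq> 1"
  proof
    assume "ratio A x y = 1"
    then have "cos (2 * pi * t) = 1" using eq by (simp add: complex_eq_iff)
    then obtain k :: int where "2 * pi * t = of_int k * 2 * pi"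
      using cos_one_2pi_int by auto
    then have "t = of_int k" by simp
    then have "real (x A) - real (y A) = of_int k * real (m A)"
      using m_pos[of A] by (simp add: t_def field_simps)
    then have "real_of_int (int (x A) - int (y A)) = real_of_int (k * int (m A))" by simp
    then have "int (x A) - int (y A) = k * int (m A)" by (simp only: of_int_eq_iff)
    moreover have "\<bar>int (x A) - int (y A)\<bar> < int (m A)"
      using assms by (auto simp: vil_space_def dest!: spec[of _ A])
    ultimately have "\<bar>k\<bar> * int (m A) < 1 * int (m A)" by (simp add: abs_mult)
    then have "\<bar>k\<bar> < 1" by (rule mult_right_less_imp_less) simp
    then have "k = 0" by simp
    with \<open>int (x A) - int (y A) = k * int (m A)\<close> False show False by simp
  qed
  moreover have "ratio A x y ^ m A = 1"
  proof -
    have "rad m A z ^ m A = 1" for z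
      using m_pos[of A] unfolding rad_def Complex.DeMoivre by (simp add: cis_multiple_2pi)
    then show ?thesis by (simp add: ratio_def power_mult_distrib flip: complex_cnj_power)
  qed
  ultimately show ?thesis using False
    by (simp add: ratio_sum_def geometric_sum)
qed

lemma psi_product_split:
  assumes "s < M m A" "b < m A"
  shows "psi m (b * M m A + s) x * cnj (psi m (b * M m A + s) y)
     = ratio A x y ^ b * (psi m s x * cnj (psi m s y))"
  using assms by (simp add: psi_split ratio_def power_mult_distrib)

section \<open>Recursion of the Dirichlet and Fejer kernels along the digits of the order\<close>

lemma dirichlet_kernel_mult:
  assumes "b \<le> m A"
  shows "dirichlet_kernel (b * M m A) x y = ratio_sum b A x y * dirichlet_kernel (M m A) x y"
proof -
  have "dirichlet_kernel (b * M m A) x y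
      = (\<Sum>c<b. \<Sum>s<M m A. ratio A x y ^ c * (psi m s x * cnj (psi m s y)))"
    unfolding dirichlet_kernel_def sum_lessThan_mult_nested
    using assms by (intro sum.cong refl psi_product_split) auto
  then show ?thesis
    by (simp add: dirichlet_kernel_def ratio_sum_def sum_product)
qed

lemma dirichlet_kernel_split:
  assumes "b < m A" "s \<le> M m A"
  shows "dirichlet_kernel (b * M m A + s) x y
    = ratio_sum b A x y * dirichlet_kernel (M m A) x y + ratio A x y ^ b * dirichlet_kernel s x y"
  using assms(2)
proof (induction s)
  case 0
  then show ?case using dirichlet_kernel_mult[of b A] assms by (simp add: dirichlet_kernel_def)
next
  case (Suc s)
  have "dirichlet_kernel (b * M m A + Suc s) x y = dirichlet_kernel (b * M m A + s) x y
      + ratio A x y ^ b * (psi m s x * cnj (psi m s y))"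
    using psi_product_split[of s A b x y] Suc.prems assms by (simp add: dirichlet_kernel_def)
  then show ?case using Suc by (simp add: dirichlet_kernel_def algebra_simps)
qed

text \<open>Paley's lemma. Each level contributes a full geometric sum, which vanishes unless the
  two points agree in that coordinate.\<close>

lemma dirichlet_kernel_M:
  assumes "x \<in> vil_space m" "y \<in> vil_space m"
  shows "dirichlet_kernel (M m A) x y = (if \<forall>j<A. x j = y j then of_nat (M m A) else 0)"
proof (induction A)
  case 0
  then show ?case by (simp add: dirichlet_kernel_def psi_def)
next
  case (Suc A)
  have "dirichlet_kernel (M m (Suc A)) x y = ratio_sum (m A) A x y * dirichlet_kernel (M m A) x y"
    unfolding M_Suc by (rule dirichlet_kernel_mult) simp
  then show ?case using Suc ratio_sum_full[OF assms, of A]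
    by (auto simp: less_Suc_eq M_Suc)
qed

lemma fejer_kernel_Suc:
  "fejer_kernel (Suc n) x y = fejer_kernel n x y + dirichlet_kernel (Suc n) x y"
  by (simp add: fejer_kernel_def)

text \<open>Sums \<open>dirichlet_kernel_split\<close> over the orders from
  \<open>b * M m A + 1\<close> to \<open>b * M m A + s\<close>; its first term does not vary with
  the order and is collected \<open>s\<close> times.\<close>

lemma fejer_kernel_split:
  assumes "b < m A" "s \<le> M m A"
  shows "fejer_kernel (b * M m A + s) x y = fejer_kernel (b * M m A) x y
    + of_nat s * ratio_sum b A x y * dirichlet_kernel (M m A) x y
    + ratio A x y ^ b * fejer_kernel s x y"
  using assms(2)
proof (induction s)
  case 0
  then show ?case by (simp add: fejer_kernel_def)
next
  case (Suc s)
  have "fejer_kernel (b * M m A + Suc s) x y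
      = fejer_kernel (b * M m A + s) x y + dirichlet_kernel (b * M m A + Suc s) x y"
    using fejer_kernel_Suc[of "b * M m A + s"] by simp
  then show ?case
    using Suc dirichlet_kernel_split[OF assms(1) Suc.prems, of x y]
    by (simp add: fejer_kernel_Suc algebra_simps)
qed

lemma fejer_kernel_mult:
  assumes "b \<le> m A"
  shows "fejer_kernel (b * M m A) x y
    = (\<Sum>c<b. ratio_sum c A x y) * of_nat (M m A) * dirichlet_kernel (M m A) x y
      + ratio_sum b A x y * fejer_kernel (M m A) x y"
  using assms
proof (induction b)
  case 0
  then show ?case by (simp add: fejer_kernel_def ratio_sum_def)
next
  case (Suc b)
  have "fejer_kernel (Suc b * M m A) x y = fejer_kernel (b * M m A + M m A) x y"
    by (simp add: add.commute)
  also have "\<dots> = fejer_kernel (b * M m A) x y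
      + of_nat (M m A) * ratio_sum b A x y * dirichlet_kernel (M m A) x y
      + ratio A x y ^ b * fejer_kernel (M m A) x y"
    using Suc.prems by (intro fejer_kernel_split) auto
  finally show ?case using Suc by (simp add: ratio_sum_def algebra_simps)
qed

text \<open>The factor \<open>ratio_sum b A x y\<close> is kept instead of being estimated by
  \<open>B\<close>: for \<open>b = m A\<close> it vanishes unless \<open>x A = y A\<close>, and this
  localisation makes the induction in \<open>avg_fejer_kernel_M_powr_le\<close> close. The factor
  \<open>B ^ 2\<close> comes from at most \<open>B\<close> geometric sums, each bounded by
  \<open>B\<close>.\<close>

lemma norm_fejer_kernel_mult_le:
  assumes "b \<le> m A"
  shows "norm (fejer_kernel (b * M m A) x y)
    \<le> real B ^ 2 * (real (M m A) * norm (dirichlet_kernel (M m A) x y))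
      + norm (ratio_sum b A x y) * norm (fejer_kernel (M m A) x y)"
proof -
  have bB: "real b \<le> real B" using assms m_le[of A] by simp
  have "norm (\<Sum>c<b. ratio_sum c A x y) \<le> (\<Sum>c<b. real B)"
  proof (intro order_trans[OF norm_sum] sum_mono)
    fix c assume "c \<in> {..<b}"
    then show "norm (ratio_sum c A x y) \<le> real B"
      using norm_ratio_sum_le[of c A x y] bB by simp
  qed
  also have "\<dots> \<le> real B ^ 2" using bB by (simp add: power2_eq_square mult_right_mono)
  finally have "norm (\<Sum>c<b. ratio_sum c A x y) * (real (M m A) * norm (dirichlet_kernel (M m A) x y))
     \<le> real B ^ 2 * (real (M m A) * norm (dirichlet_kernel (M m A) x y))"
    by (rule mult_right_mono) simp
  then show ?thesis
    unfolding fejer_kernel_mult[OF assms]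
    by (intro order_trans[OF norm_triangle_ineq]) (simp add: norm_mult mult.assoc)
qed

text \<open>The leading digit of \<open>n\<close> is peeled off and the remainder \<open>s\<close>
  is treated recursively; the unimodular factor in front of its kernel disappears in the norm. Each
  level pays two terms of Dirichlet type, hence \<open>2 * real B ^ 2\<close>.\<close>

lemma norm_fejer_kernel_le:
  assumes "n < M m A"
  shows "norm (fejer_kernel n x y) \<le>
    (\<Sum>j<A. 2 * real B ^ 2 * (real (M m j) * norm (dirichlet_kernel (M m j) x y))
          + real B * norm (fejer_kernel (M m j) x y))"
  using assms
proof (induction A arbitrary: n)
  case 0
  then show ?case by (simp add: fejer_kernel_def)
next
  case (Suc A)
  obtain b s where n: "n = b * M m A + s" "s < M m A" "b < m A"
    using M_split[OF Suc.prems] .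
  define D where "D = real (M m A) * norm (dirichlet_kernel (M m A) x y)"
  define F where "F = norm (fejer_kernel (M m A) x y)"
  have nn: "0 \<le> D" "0 \<le> F" by (simp_all add: D_def F_def)
  have bB: "real b \<le> real B" using n m_le[of A] by simp
  have B1: "1 \<le> real B" using m_ge[of A] m_le[of A] by simp
  have rb: "norm (ratio_sum b A x y) \<le> real B"
    using norm_ratio_sum_le[of b A x y] bB by simp
  have "norm (fejer_kernel n x y) \<le> norm (fejer_kernel (b * M m A) x y)
      + norm (of_nat s * ratio_sum b A x y * dirichlet_kernel (M m A) x y)
      + norm (ratio A x y ^ b * fejer_kernel s x y)"
    using fejer_kernel_split[of b A s x y] n
    by (simp add: norm_triangle_le norm_triangle_ineq)
  moreover have "norm (fejer_kernel (b * M m A) x y) \<le> real B ^ 2 * D + real B * F"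
  proof -
    have "norm (ratio_sum b A x y) * F \<le> real B * F"
      using rb nn by (intro mult_right_mono)
    then show ?thesis using norm_fejer_kernel_mult_le[of b A x y] n by (simp add: D_def F_def)
  qed
  moreover have "norm (of_nat s * ratio_sum b A x y * dirichlet_kernel (M m A) x y) \<le> real B ^ 2 * D"
  proof -
    have "norm (of_nat s * ratio_sum b A x y * dirichlet_kernel (M m A) x y)
        = norm (ratio_sum b A x y) * (real s * norm (dirichlet_kernel (M m A) x y))"
      by (simp add: norm_mult)
    also have "\<dots> \<le> real B * D"
      unfolding D_def using rb n by (intro mult_mono mult_right_mono) auto
    also have "\<dots> \<le> real B ^ 2 * D"
      using B1 nn by (intro mult_right_mono) (auto simp: power2_eq_square)
    finally show ?thesis .
  qed
  moreover have "norm (ratio A x y ^ b * fejer_kernel s x y) = norm (fejer_kernel s x y)"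
    by (simp add: norm_mult norm_power)
  ultimately show ?case using Suc.IH[OF n(2)] by (simp add: D_def F_def)
qed

subsection \<open>Averages over atoms\<close>

text \<open>The points \<open>digit m a\<close> with \<open>a < M m J\<close> represent the atoms of level \<open>J\<close>.\<close>

definition avg :: "nat \<Rightarrow> ((nat \<Rightarrow> nat) \<Rightarrow> 'a::field_char_0) \<Rightarrow> 'a" where
  "avg J h = (\<Sum>a<M m J. h (digit m a)) / of_nat (M m J)"

text \<open>Measurability with respect to the sigma-algebra of level \<open>J\<close>, expressed
  pointwise. Only points of the space are compared, since \<open>vil_martingale\<close> says nothing
  about other points.\<close>

definition depends :: "nat \<Rightarrow> ((nat \<Rightarrow> nat) \<Rightarrow> 'a) \<Rightarrow> bool" where
  "depends J h \<longleftrightarrow> (\<forall>x\<in>vil_space m. \<forall>y\<in>vil_space m. (\<forall>j<J. x j = y j) \<longrightarrow> h x = h y)"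

lemma dependsI:
  "(\<And>x y. x \<in> vil_space m \<Longrightarrow> y \<in> vil_space m \<Longrightarrow> \<forall>j<J. x j = y j \<Longrightarrow> h x = h y) \<Longrightarrow> depends J h"
  unfolding depends_def by blast

lemma dependsD:
  "depends J h \<Longrightarrow> x \<in> vil_space m \<Longrightarrow> y \<in> vil_space m \<Longrightarrow> \<forall>j<J. x j = y j \<Longrightarrow> h x = h y"
  unfolding depends_def by blast

lemma depends_mono: "depends J h \<Longrightarrow> J \<le> K \<Longrightarrow> depends K h"
  unfolding depends_def by (meson order_less_le_trans)

lemma depends_const: "depends J (\<lambda>x. c)"
  by (simp add: depends_def)

lemma depends_comp: "depends J h \<Longrightarrow> depends J (\<lambda>x. F (h x))"
  unfolding depends_def by metis

lemma depends_comp2: "depends J h \<Longrightarrow> depends J h' \<Longrightarrow> depends J (\<lambda>x. F (h x) (h' x))"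
  unfolding depends_def by metis

lemma depends_psi: "i < M m J \<Longrightarrow> depends J (psi m i)"
  unfolding depends_def using psi_cong by blast

lemma depends_dirichlet_kernel:
  assumes "n \<le> M m J"
  shows "depends J (\<lambda>x. dirichlet_kernel n x y)" "depends J (dirichlet_kernel n x)"
proof -
  have "dirichlet_kernel n x y = dirichlet_kernel n x' y'"
    if "\<forall>j<J. x j = x' j" "\<forall>j<J. y j = y' j" for x y x' y'
    unfolding dirichlet_kernel_def
  proof (intro sum.cong refl)
    fix i assume "i \<in> {..<n}"
    then have i: "i < M m J" using assms by simp
    show "psi m i x * cnj (psi m i y) = psi m i x' * cnj (psi m i y')"
      using psi_cong[OF i that(1)] psi_cong[OF i that(2)] by simp
  qed
  then show "depends J (\<lambda>x. dirichlet_kernel n x y)" "depends J (dirichlet_kernel n x)"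
    by (simp_all add: depends_def)
qed

lemma depends_fejer_kernel:
  assumes "n \<le> M m J"
  shows "depends J (\<lambda>x. fejer_kernel n x y)"
proof (rule dependsI)
  fix x x' assume *: "x \<in> vil_space m" "x' \<in> vil_space m" "\<forall>j<J. x j = x' j"
  show "fejer_kernel n x y = fejer_kernel n x' y"
    unfolding fejer_kernel_def
    using assms by (intro sum.cong refl dependsD[OF depends_dirichlet_kernel(1) *]) auto
qed

lemma obtain_digits:
  assumes "x \<in> vil_space m"
  obtains a0 where "a0 < M m A" "\<And>a. a < M m A \<Longrightarrow> (\<forall>j<A. x j = digit m a j) \<longleftrightarrow> a = a0"
proof -
  obtain a0 where a0: "a0 < M m A" "\<forall>j<A. digit m a0 j = x j"
    using ex_digits[OF assms] by blast
  show ?thesis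
  proof (rule that)
    show "a0 < M m A" by fact
    show "(\<forall>j<A. x j = digit m a j) \<longleftrightarrow> a = a0" if "a < M m A" for a
      using a0 digits_unique[OF that a0(1)] by auto
  qed
qed

text \<open>Decomposition of a step function into indicators of atoms: exactly one representative
  lies in the atom of \<open>x\<close>, so a single summand survives.\<close>

lemma sum_atoms:
  fixes h :: "(nat \<Rightarrow> nat) \<Rightarrow> 'a::comm_monoid_add"
  assumes "depends A h" "x \<in> vil_space m"
  shows "(\<Sum>a<M m A. if \<forall>j<A. x j = digit m a j then h (digit m a) else 0) = h x"
proof -
  obtain a0 where a0: "a0 < M m A" "\<And>a. a < M m A \<Longrightarrow> (\<forall>j<A. x j = digit m a j) \<longleftrightarrow> a = a0"
    using obtain_digits[OF assms(2), of A] by blast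
  have "(\<Sum>a<M m A. if \<forall>j<A. x j = digit m a j then h (digit m a) else 0)
      = (\<Sum>a<M m A. if a = a0 then h (digit m a) else 0)"
    using a0 by (intro sum.cong) auto
  also have "\<dots> = h (digit m a0)" using a0 by simp
  also have "\<dots> = h x"
    using a0(2)[OF a0(1)] assms by (intro dependsD[OF assms(1)]) (auto simp: digit_in_space)
  finally show ?thesis .
qed

lemma avg_Suc_nested:
  "avg (Suc J) h = (\<Sum>c<m J. \<Sum>s<M m J. h (digit m (c * M m J + s))) / (of_nat (m J) * of_nat (M m J))"
  by (simp add: avg_def M_Suc sum_lessThan_mult_nested)

lemma depends_digit_add:
  "depends J h \<Longrightarrow> h (digit m (c * M m J + s)) = h (digit m s)"
  by (rule dependsD[of J h]) (auto simp: digit_in_space digit_low)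

lemma avg_Suc:
  assumes "depends J h"
  shows "avg (Suc J) h = avg J h"
  using m_pos[of J] unfolding avg_Suc_nested
  by (simp add: depends_digit_add[OF assms] avg_def)

text \<open>A digit that \<open>h\<close> does not see is averaged trivially, so a step function has
  one mean regardless of the level at which it is computed; \<open>integral_depends\<close>
  identifies it with the integral.\<close>

lemma avg_level:
  assumes "depends J h" "J \<le> K"
  shows "avg K h = avg J h"
  using assms(2)
proof (induction K rule: dec_induct)
  case (step K)
  then show ?case using avg_Suc[OF depends_mono[OF assms(1)], of K] by simp
qed simp

lemma avg_cong:
  "(\<And>x. x \<in> vil_space m \<Longrightarrow> h x = h' x) \<Longrightarrow> avg J h = avg J h'"
  by (simp add: avg_def digit_in_space)

lemma avg_mono:
  fixes h h' :: "(nat \<Rightarrow> nat) \<Rightarrow> real"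
  shows "(\<And>x. x \<in> vil_space m \<Longrightarrow> h x \<le> h' x) \<Longrightarrow> avg J h \<le> avg J h'"
  by (simp add: avg_def digit_in_space divide_right_mono sum_mono)

lemma avg_nonneg:
  fixes h :: "(nat \<Rightarrow> nat) \<Rightarrow> real"
  shows "(\<And>x. 0 \<le> h x) \<Longrightarrow> 0 \<le> avg J h"
  by (simp add: avg_def sum_nonneg)

lemma avg_add: "avg J (\<lambda>x. h x + h' x) = avg J h + avg J h'"
  by (simp add: avg_def sum.distrib add_divide_distrib)

lemma avg_cmult: "avg J (\<lambda>x. c * h x) = c * avg J h"
  by (simp add: avg_def sum_distrib_left)

lemma avg_sum: "avg J (\<lambda>x. \<Sum>i\<in>S. h i x) = (\<Sum>i\<in>S. avg J (h i))"
  unfolding avg_def by (subst sum.swap) (simp add: sum_divide_distrib)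

lemma avg_atom:
  assumes "y \<in> vil_space m"
  shows "avg A (\<lambda>x. if \<forall>j<A. x j = y j then c else 0) = c / of_nat (M m A)"
proof -
  have "(\<forall>j<A. digit m a j = y j) \<longleftrightarrow> (\<forall>j<A. y j = digit m a j)" for a
    by metis
  then show ?thesis
    using sum_atoms[OF depends_const assms, of A c] by (simp add: avg_def)
qed

text \<open>Coordinate \<open>A\<close> is independent of the first \<open>A\<close> coordinates and
  takes each value with probability \<open>1 / m A\<close>.\<close>

lemma avg_restrict_coordinate:
  assumes "depends A h" "t < m A"
  shows "avg (Suc A) (\<lambda>x. if x A = t then h x else 0) = avg A h / of_nat (m A)"
proof -
  have "(\<Sum>s<M m A. if digit m (c * M m A + s) A = t then h (digit m (c * M m A + s)) else 0)
      = (if c = t then \<Sum>s<M m A. h (digit m s) else 0)" if "c < m A" for c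
  proof -
    have "(\<Sum>s<M m A. if digit m (c * M m A + s) A = t then h (digit m (c * M m A + s)) else 0)
        = (\<Sum>s<M m A. if c = t then h (digit m s) else 0)"
      using that by (intro sum.cong) (simp_all add: digit_top depends_digit_add[OF assms(1)])
    then show ?thesis by simp
  qed
  then have "(\<Sum>c<m A. \<Sum>s<M m A. if digit m (c * M m A + s) A = t then h (digit m (c * M m A + s)) else 0)
      = (\<Sum>c<m A. if c = t then \<Sum>s<M m A. h (digit m s) else 0)"
    by (intro sum.cong) auto
  also have "\<dots> = (\<Sum>s<M m A. h (digit m s))" using assms by simp
  finally show ?thesis unfolding avg_Suc_nested by (simp add: avg_def)
qed

section \<open>Haar measure of atoms and integrals of step functions\<close>

lemma space_vil_mu: "space (vil_mu m) = vil_space m"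
  by (auto simp: vil_mu_def space_PiM space_uniform_count_measure vil_space_def PiE_def Pi_def)

lemma emeasure_atom:
  assumes "y \<in> vil_space m"
  shows "emeasure (vil_mu m) (I_n m J y) = ennreal (1 / real (M m J))"
    and "I_n m J y \<in> sets (vil_mu m)"
proof -
  interpret product_prob_space "\<lambda>k. uniform_count_measure {..<m k}" UNIV
    using m_pos by (intro product_prob_spaceI prob_space_uniform_count_measure) (auto simp: lessThan_empty_iff)
  have I: "I_n m J y = {x \<in> space (vil_mu m). \<forall>j\<in>{..<J}. x j \<in> {y j}}"
    by (auto simp: I_n_def space_vil_mu)
  have y: "{y j} \<subseteq> {..<m j}" for j using assms by (auto simp: vil_space_def)
  have "emeasure (vil_mu m) (I_n m J y) = (\<Prod>j<J. emeasure (uniform_count_measure {..<m j}) {y j})"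
    unfolding I vil_mu_def using y
    by (intro emeasure_PiM_Collect) (auto simp: sets_uniform_count_measure)
  also have "\<dots> = (\<Prod>j<J. ennreal (1 / real (m j)))"
    using y by (intro prod.cong refl) (simp add: emeasure_uniform_count_measure)
  also have "\<dots> = ennreal (1 / real (M m J))"
    by (simp add: prod_ennreal M_def prod_dividef)
  finally show "emeasure (vil_mu m) (I_n m J y) = ennreal (1 / real (M m J))" .
  show "I_n m J y \<in> sets (vil_mu m)"
    unfolding I vil_mu_def
    by (intro sets.sets_Collect_finite_All sets_Collect_single')
      (auto simp: sets_uniform_count_measure space_uniform_count_measure)
qed

lemma measure_atom: "y \<in> vil_space m \<Longrightarrow> measure (vil_mu m) (I_n m J y) = 1 / real (M m J)"
  by (simp add: measure_def emeasure_atom)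

text \<open>Every preimage is a union of finitely many atoms.\<close>

lemma measurable_depends:
  assumes "depends J h"
  shows "h \<in> borel_measurable (vil_mu m)"
proof (rule measurableI)
  fix S
  have "h -` S \<inter> space (vil_mu m) = (\<Union>a\<in>{a. a < M m J \<and> h (digit m a) \<in> S}. I_n m J (digit m a))"
  proof (intro subset_antisym subsetI)
    fix x assume "x \<in> h -` S \<inter> space (vil_mu m)"
    then have x: "x \<in> vil_space m" "h x \<in> S" by (auto simp: space_vil_mu)
    obtain a where a: "a < M m J" "\<forall>j<J. digit m a j = x j" using ex_digits[OF x(1)] by blast
    then have "h x = h (digit m a)" using x digit_in_space by (intro dependsD[OF assms]) auto
    then show "x \<in> (\<Union>a\<in>{a. a < M m J \<and> h (digit m a) \<in> S}. I_n m J (digit m a))"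
      using a x by (auto simp: I_n_def)
  next
    fix x assume "x \<in> (\<Union>a\<in>{a. a < M m J \<and> h (digit m a) \<in> S}. I_n m J (digit m a))"
    then obtain a where a: "h (digit m a) \<in> S" "x \<in> vil_space m" "\<forall>j<J. x j = digit m a j"
      by (auto simp: I_n_def)
    then have "h x = h (digit m a)" using digit_in_space by (intro dependsD[OF assms]) auto
    then show "x \<in> h -` S \<inter> space (vil_mu m)" using a by (auto simp: space_vil_mu)
  qed
  then show "h -` S \<inter> space (vil_mu m) \<in> sets (vil_mu m)"
    using emeasure_atom(2)[OF digit_in_space] by auto
qed simp

text \<open>Reduces integration to finite sums: on the space, \<open>h\<close> is a combination of
  indicators of atoms, each of mass \<open>1 / M m J\<close>.\<close>

lemma has_bochner_integral_depends:
  fixes h :: "(nat \<Rightarrow> nat) \<Rightarrow> 'a::{real_normed_field, banach, second_countable_topology}"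
  assumes "depends J h"
  shows "has_bochner_integral (vil_mu m) h (avg J h)"
proof -
  have "has_bochner_integral (vil_mu m) (\<lambda>x. \<Sum>a<M m J. indicator (I_n m J (digit m a)) x *\<^sub>R h (digit m a))
      (\<Sum>a<M m J. measure (vil_mu m) (I_n m J (digit m a)) *\<^sub>R h (digit m a))"
    by (intro has_bochner_integral_sum has_bochner_integral_indicator)
      (auto simp: emeasure_atom digit_in_space)
  moreover have "(\<Sum>a<M m J. measure (vil_mu m) (I_n m J (digit m a)) *\<^sub>R h (digit m a)) = avg J h"
    by (simp add: measure_atom digit_in_space avg_def scaleR_conv_of_real sum_divide_distrib)
  moreover have "(\<Sum>a<M m J. indicator (I_n m J (digit m a)) x *\<^sub>R h (digit m a)) = h x"
    if x: "x \<in> vil_space m" for x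
  proof -
    have "(\<Sum>a<M m J. indicator (I_n m J (digit m a)) x *\<^sub>R h (digit m a))
        = (\<Sum>a<M m J. if \<forall>j<J. x j = digit m a j then h (digit m a) else 0)"
      using x by (intro sum.cong) (auto simp: I_n_def indicator_def)
    then show ?thesis using sum_atoms[OF assms x] by simp
  qed
  ultimately show ?thesis
    by (subst has_bochner_integral_cong[OF refl, of _ h]) (auto simp: space_vil_mu)
qed

lemma integral_depends:
  fixes h :: "(nat \<Rightarrow> nat) \<Rightarrow> 'a::{real_normed_field, banach, second_countable_topology}"
  shows "depends J h \<Longrightarrow> (\<integral>x. h x \<partial>vil_mu m) = avg J h"
  using has_bochner_integral_depends has_bochner_integral_integral_eq by blast

lemma nn_integral_depends:
  fixes h :: "(nat \<Rightarrow> nat) \<Rightarrow> real"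
  assumes "depends J h" "\<And>x. 0 \<le> h x"
  shows "(\<integral>\<^sup>+ x. ennreal (h x) \<partial>vil_mu m) = ennreal (avg J h)"
  using has_bochner_integral_depends[OF assms(1)] assms(2)
  by (subst nn_integral_eq_integral) (auto simp: has_bochner_integral_iff)

subsection \<open>Martingales and the Fejer operator\<close>

lemma integral_atom:
  fixes h :: "(nat \<Rightarrow> nat) \<Rightarrow> complex"
  assumes "depends K h" "J \<le> K" "y \<in> vil_space m"
  shows "(\<integral>x\<in>I_n m J y. h x \<partial>vil_mu m) = avg K (\<lambda>x. if \<forall>j<J. x j = y j then h x else 0)"
proof -
  have dep: "depends K (\<lambda>x. if \<forall>j<J. x j = y j then h x else 0)"
  proof (rule dependsI)
    fix x x' assume x: "x \<in> vil_space m" "x' \<in> vil_space m" "\<forall>j<K. x j = x' j"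
    have "h x = h x'" by (rule dependsD[OF assms(1) x])
    moreover have "(\<forall>j<J. x j = y j) = (\<forall>j<J. x' j = y j)" using x assms(2) by auto
    ultimately show "(if \<forall>j<J. x j = y j then h x else 0) = (if \<forall>j<J. x' j = y j then h x' else 0)"
      by (simp only:)
  qed
  have "(\<integral>x\<in>I_n m J y. h x \<partial>vil_mu m)
      = (\<integral>x. (if \<forall>j<J. x j = y j then h x else 0) \<partial>vil_mu m)"
    unfolding set_lebesgue_integral_def
    by (rule Bochner_Integration.integral_cong) (auto simp: I_n_def space_vil_mu indicator_def)
  then show ?thesis by (simp add: integral_depends[OF dep])
qed

lemma martingale_depends: "vil_martingale m f \<Longrightarrow> depends n (f n)"
  unfolding vil_martingale_def depends_def by blast

text \<open>\<open>vil_martingale\<close> tests the martingale property on single atoms. Cutting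
  \<open>h\<close> into its pieces \<open>u a\<close> on the atoms of level \<open>k\<close> extends
  it by linearity to all test functions of that level.\<close>

lemma martingale_step:
  assumes f: "vil_martingale m f" and h: "depends k h"
  shows "avg (Suc k) (\<lambda>x. f (Suc k) x * h x) = avg k (\<lambda>x. f k x * h x)"
proof -
  have d: "depends k (f k)" "depends (Suc k) (f (Suc k))" "depends (Suc k) (f k)"
    using martingale_depends[OF f] depends_mono[OF martingale_depends[OF f], of k "Suc k"] by auto
  define u where "u a x = (if \<forall>j<k. x j = digit m a j then h (digit m a) else 0)" for a x
  have u: "(\<Sum>a<M m k. u a x) = h x" if "x \<in> vil_space m" for x
    unfolding u_def by (rule sum_atoms[OF h that])
  have "avg (Suc k) (\<lambda>x. f (Suc k) x * u a x) = avg (Suc k) (\<lambda>x. f k x * u a x)" for a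
  proof -
    have "avg (Suc k) (\<lambda>x. if \<forall>j<k. x j = digit m a j then f (Suc k) x else 0)
        = (\<integral>y\<in>I_n m k (digit m a). f (Suc k) y \<partial>vil_mu m)"
      using d by (intro integral_atom [symmetric]) (auto simp: digit_in_space)
    also have "\<dots> = (\<integral>y\<in>I_n m k (digit m a). f k y \<partial>vil_mu m)"
      using f digit_in_space unfolding vil_martingale_def by blast
    also have "\<dots> = avg (Suc k) (\<lambda>x. if \<forall>j<k. x j = digit m a j then f k x else 0)"
      using d by (intro integral_atom) (auto simp: digit_in_space)
    finally have *: "avg (Suc k) (\<lambda>x. if \<forall>j<k. x j = digit m a j then f (Suc k) x else 0)
      = avg (Suc k) (\<lambda>x. if \<forall>j<k. x j = digit m a j then f k x else 0)" .
    have "F x * u a x = h (digit m a) * (if \<forall>j<k. x j = digit m a j then F x else 0)" for F x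
      by (auto simp: u_def)
    then show ?thesis by (simp only: avg_cmult *)
  qed
  then have "avg (Suc k) (\<lambda>x. \<Sum>a<M m k. f (Suc k) x * u a x)
      = avg (Suc k) (\<lambda>x. \<Sum>a<M m k. f k x * u a x)"
    by (simp add: avg_sum)
  moreover have "avg (Suc k) (\<lambda>x. \<Sum>a<M m k. F x * u a x) = avg (Suc k) (\<lambda>x. F x * h x)" for F
    by (rule avg_cong) (simp add: u flip: sum_distrib_left)
  ultimately have "avg (Suc k) (\<lambda>x. f (Suc k) x * h x) = avg (Suc k) (\<lambda>x. f k x * h x)"
    by simp
  also have "\<dots> = avg k (\<lambda>x. f k x * h x)"
    by (intro avg_Suc depends_comp2[OF d(1) h])
  finally show ?thesis .
qed

lemma martingale_le:
  assumes f: "vil_martingale m f" and h: "depends k h" and "k \<le> n"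
  shows "avg n (\<lambda>x. f n x * h x) = avg k (\<lambda>x. f k x * h x)"
  using assms(3)
proof (induction n rule: dec_induct)
  case (step n)
  then show ?case using martingale_step[OF f depends_mono[OF h, of n]] by simp
qed simp

lemma condexp_depends:
  fixes h :: "(nat \<Rightarrow> nat) \<Rightarrow> complex"
  assumes "depends k h" "x \<in> vil_space m"
  shows "condexp_n m k h x = h x"
proof -
  have "avg k (\<lambda>y. if \<forall>j<k. y j = x j then h y else 0)
      = avg k (\<lambda>y. if \<forall>j<k. y j = x j then h x else 0)"
    using assms by (intro avg_cong if_cong refl dependsD[OF assms(1)]) auto
  then show ?thesis
    using M_pos[of k] by (simp add: condexp_n_def integral_atom[OF assms(1) order_refl assms(2)]
        avg_atom[OF assms(2)] measure_atom[OF assms(2)])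
qed

text \<open>The indicator of the atom of \<open>x\<close> is a test function of level
  \<open>k\<close>, so \<open>martingale_le\<close> replaces \<open>f n\<close> by
  \<open>f k\<close> under the integral.\<close>

lemma condexp_martingale:
  assumes "vil_martingale m f" "k \<le> n" "x \<in> vil_space m"
  shows "condexp_n m k (f n) x = f k x"
proof -
  define h where "h y = (if \<forall>j<k. y j = x j then 1 else 0 :: complex)" for y
  have h: "depends k h" by (simp add: depends_def h_def)
  have "avg l (\<lambda>y. if \<forall>j<k. y j = x j then f l y else 0) = avg l (\<lambda>y. f l y * h y)" for l
    by (rule avg_cong) (auto simp: h_def)
  then have "condexp_n m k (f n) x = condexp_n m k (f k) x"
    using martingale_le[OF assms(1) h assms(2)]
    by (simp add: condexp_n_def integral_atom[OF martingale_depends[OF assms(1)]] assms)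
  then show ?thesis by (simp add: condexp_depends[OF martingale_depends[OF assms(1)] assms(3)])
qed

text \<open>Not normalised: the Fejer mean is \<open>fejer_op J n h / n\<close>.\<close>

definition fejer_op :: "nat \<Rightarrow> nat \<Rightarrow> ((nat \<Rightarrow> nat) \<Rightarrow> complex) \<Rightarrow> (nat \<Rightarrow> nat) \<Rightarrow> complex" where
  "fejer_op J n h x = avg J (\<lambda>y. h y * fejer_kernel n x y)"

section \<open>Fourier coefficients, partial sums and Fejer means of a martingale\<close>

lemma fourier_coeff_martingale:
  assumes "vil_martingale m f" "i < M m J"
  shows "fourier_coeff m f i = avg J (\<lambda>x. f J x * cnj (psi m i x))"
proof -
  have dep: "depends J (\<lambda>x. cnj (psi m i x))" by (rule depends_comp[OF depends_psi[OF assms(2)]])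
  have "(\<integral>x. f k x * cnj (psi m i x) \<partial>vil_mu m) = avg J (\<lambda>x. f J x * cnj (psi m i x))" if "J \<le> k" for k
  proof -
    have "depends k (\<lambda>x. f k x * cnj (psi m i x))"
      by (rule depends_comp2[OF martingale_depends[OF assms(1)] depends_mono[OF dep that], of "(*)"])
    then show ?thesis
      using martingale_le[OF assms(1) dep that] by (simp add: integral_depends)
  qed
  \<comment> \<open>The sequence of integrals is constant from index \<open>J\<close> on, so the
    limit in \<open>fourier_coeff\<close> is attained at level \<open>J\<close>.\<close>
  then have "(\<lambda>k. \<integral>x. f k x * cnj (psi m i x) \<partial>vil_mu m) \<longlonglongrightarrow> avg J (\<lambda>x. f J x * cnj (psi m i x))"
    by (intro tendsto_eventually eventually_sequentiallyI[of J]) auto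
  then show ?thesis unfolding fourier_coeff_def by (rule limI)
qed

lemma avg_dirichlet_kernel:
  "avg J (\<lambda>y. h y * dirichlet_kernel k x y) = (\<Sum>i<k. avg J (\<lambda>y. h y * cnj (psi m i y)) * psi m i x)"
proof -
  have "avg J (\<lambda>y. h y * dirichlet_kernel k x y)
      = avg J (\<lambda>y. \<Sum>i<k. psi m i x * (h y * cnj (psi m i y)))"
    by (simp add: dirichlet_kernel_def sum_distrib_left mult_ac)
  then show ?thesis by (simp add: avg_sum avg_cmult mult.commute)
qed

lemma partial_sum_martingale:
  assumes "vil_martingale m f" "k \<le> M m J"
  shows "partial_sum m f k x = avg J (\<lambda>y. f J y * dirichlet_kernel k x y)"
  unfolding avg_dirichlet_kernel partial_sum_def
  using assms by (intro sum.cong) (auto simp: fourier_coeff_martingale[where J = J])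

text \<open>The kernel is \<open>M m J\<close> times the indicator of the atom of \<open>x\<close>;
  \<open>h\<close> is constant on this atom, whose mass is \<open>1 / M m J\<close>.\<close>

lemma avg_dirichlet_kernel_M:
  assumes "depends J h" "x \<in> vil_space m"
  shows "avg J (\<lambda>y. h y * dirichlet_kernel (M m J) x y) = h x"
proof -
  have "avg J (\<lambda>y. h y * dirichlet_kernel (M m J) x y)
      = avg J (\<lambda>y. if \<forall>j<J. y j = x j then h x * of_nat (M m J) else 0)"
  proof (rule avg_cong)
    fix y assume y: "y \<in> vil_space m"
    have eq: "(\<forall>j<J. x j = y j) \<longleftrightarrow> (\<forall>j<J. y j = x j)" by metis
    show "h y * dirichlet_kernel (M m J) x y
        = (if \<forall>j<J. y j = x j then h x * of_nat (M m J) else 0)"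
    proof (cases "\<forall>j<J. y j = x j")
      case True
      then have "h y = h x" by (rule dependsD[OF assms(1) y assms(2)])
      with True show ?thesis using dirichlet_kernel_M[OF assms(2) y, of J] by auto
    next
      case False
      with eq show ?thesis using dirichlet_kernel_M[OF assms(2) y, of J] by auto
    qed
  qed
  then show ?thesis using M_pos[of J] by (simp add: avg_atom[OF assms(2)])
qed

lemma partial_sum_M:
  assumes "vil_martingale m f" "x \<in> vil_space m"
  shows "partial_sum m f (M m J) x = f J x"
  by (simp add: partial_sum_martingale[OF assms(1), of _ J]
      avg_dirichlet_kernel_M[OF martingale_depends[OF assms(1)] assms(2)])

lemma fejer_op_eq_sum:
  "fejer_op J n h x = (\<Sum>k=1..n. avg J (\<lambda>y. h y * dirichlet_kernel k x y))"
  by (simp add: fejer_op_def fejer_kernel_def sum_distrib_left avg_sum)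

lemma fejer_martingale:
  assumes "vil_martingale m f" "n \<le> M m J"
  shows "fejer m f n x = fejer_op J n (f J) x / of_nat n"
  unfolding fejer_op_eq_sum fejer_def
  using assms by (auto simp: partial_sum_martingale[where J = J] intro!: arg_cong2[where f = "(/)"] sum.cong)

text \<open>The leading digit of \<open>i\<close> is nonzero, so \<open>psi m i\<close> contains a
  nontrivial power of \<open>rad m N\<close>. Averaging over coordinate \<open>N\<close>, which
  \<open>h\<close> does not see, gives zero.\<close>

lemma avg_psi_eq_0:
  assumes "depends N h" "M m N \<le> i" "i < M m (Suc N)"
  shows "avg (Suc N) (\<lambda>y. h y * cnj (psi m i y)) = 0"
proof -
  obtain b s where i: "i = b * M m N + s" "s < M m N" "b < m N" using M_split[OF assms(3)] by blast
  have b: "b \<noteq> 0" using i assms(2) by (intro notI) simp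
  define r where "r c = cnj (rad m N (digit m (c * M m N)) ^ b)" for c
  have rad: "rad m N (digit m (c * M m N + t)) = rad m N (digit m (c * M m N))"
    if "c < m N" "t < M m N" for c t
    using that digit_top[of t N c] digit_top[of 0 N c] M_pos[of N] by (simp add: rad_def)
  have dep: "depends N (\<lambda>y. h y * cnj (psi m s y))"
    by (intro depends_comp2[OF assms(1) depends_psi[OF i(2)]])
  \<comment> \<open>\<open>ratio_sum_full\<close> is reused with exponent and coordinate exchanged:
    the summation index \<open>c\<close> becomes the power, and \<open>b\<close> becomes coordinate
    \<open>N\<close> of the first point.\<close>
  have "(\<Sum>c<m N. r c) = cnj (ratio_sum (m N) N (digit m (b * M m N)) (digit m 0))"
  proof -
    have "cnj (r c) = ratio N (digit m (b * M m N)) (digit m 0) ^ c" if "c < m N" for c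
    proof -
      have "digit m (c * M m N) N = c" "digit m (b * M m N) N = b" "digit m 0 N = 0"
        using digit_top[of 0 N c] digit_top[of 0 N b] that i M_pos[of N] by (auto simp: digit_def)
      then show ?thesis by (simp add: r_def ratio_def rad_def Complex.DeMoivre mult_ac)
    qed
    then have "r c = cnj (ratio N (digit m (b * M m N)) (digit m 0) ^ c)" if "c < m N" for c
      using that by (metis complex_cnj_cnj)
    then have "(\<Sum>c<m N. r c) = (\<Sum>c<m N. cnj (ratio N (digit m (b * M m N)) (digit m 0) ^ c))"
      by (intro sum.cong) auto
    then show ?thesis by (simp add: ratio_sum_def)
  qed
  also have "\<dots> = 0"
    using digit_top[of 0 N b] i M_pos[of N] b
    by (subst ratio_sum_full) (auto simp: digit_in_space digit_def)
  finally have r0: "(\<Sum>c<m N. r c) = 0" .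
  have "(\<Sum>c<m N. \<Sum>t<M m N. h (digit m (c * M m N + t)) * cnj (psi m i (digit m (c * M m N + t))))
      = (\<Sum>c<m N. \<Sum>t<M m N. r c * (h (digit m t) * cnj (psi m s (digit m t))))"
  proof (intro sum.cong refl)
    fix c t assume "c \<in> {..<m N}" "t \<in> {..<M m N}"
    then have ct: "c < m N" "t < M m N" by auto
    show "h (digit m (c * M m N + t)) * cnj (psi m i (digit m (c * M m N + t)))
        = r c * (h (digit m t) * cnj (psi m s (digit m t)))"
      using depends_digit_add[OF dep, of c t] i
      by (simp add: psi_split rad[OF ct] r_def mult_ac)
  qed
  also have "\<dots> = (\<Sum>c<m N. r c) * (\<Sum>t<M m N. h (digit m t) * cnj (psi m s (digit m t)))"
    by (simp add: sum_product)
  finally show ?thesis unfolding avg_Suc_nested by (simp add: r0)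
qed

lemma avg_dirichlet_kernel_between:
  assumes "depends N h" "M m N \<le> k" "k \<le> M m (Suc N)" "x \<in> vil_space m"
  shows "avg (Suc N) (\<lambda>y. h y * dirichlet_kernel k x y) = h x"
proof -
  have "avg (Suc N) (\<lambda>y. h y * dirichlet_kernel k x y)
      = (\<Sum>i<M m N. avg (Suc N) (\<lambda>y. h y * cnj (psi m i y)) * psi m i x)"
    unfolding avg_dirichlet_kernel using assms
    by (intro sum.mono_neutral_right) (auto simp: avg_psi_eq_0)
  also have "\<dots> = avg (Suc N) (\<lambda>y. h y * dirichlet_kernel (M m N) x y)"
    by (rule avg_dirichlet_kernel [symmetric])
  also have "\<dots> = avg N (\<lambda>y. h y * dirichlet_kernel (M m N) x y)"
    by (intro avg_Suc depends_comp2[OF assms(1) depends_dirichlet_kernel(2)]) simp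
  also have "\<dots> = h x" by (rule avg_dirichlet_kernel_M[OF assms(1,4)])
  finally show ?thesis .
qed

text \<open>By \<open>avg_dirichlet_kernel_between\<close> every partial sum of order from
  \<open>M m N\<close> to \<open>M m (Suc N)\<close> reproduces \<open>h\<close>. The orders beyond
  \<open>M m N\<close> thus contribute one copy of \<open>h x\<close> each, and the others form the
  operator of level \<open>N\<close>.\<close>

lemma fejer_op_between:
  assumes "depends N h" "M m N \<le> n" "n \<le> M m (Suc N)" "x \<in> vil_space m"
  shows "fejer_op (Suc N) n h x = of_nat (n - M m N) * h x + fejer_op N (M m N) h x"
proof -
  have "fejer_op (Suc N) n h x
      = (\<Sum>k=1..M m N. avg (Suc N) (\<lambda>y. h y * dirichlet_kernel k x y))
        + (\<Sum>k=M m N + 1..n. avg (Suc N) (\<lambda>y. h y * dirichlet_kernel k x y))"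
    unfolding fejer_op_eq_sum using assms(2) sum.ub_add_nat[of 1 "M m N" _ "n - M m N"] by simp
  also have "(\<Sum>k=1..M m N. avg (Suc N) (\<lambda>y. h y * dirichlet_kernel k x y)) = fejer_op N (M m N) h x"
    unfolding fejer_op_eq_sum
    by (intro sum.cong refl avg_Suc depends_comp2[OF assms(1) depends_dirichlet_kernel(2)]) simp
  also have "(\<Sum>k=M m N + 1..n. avg (Suc N) (\<lambda>y. h y * dirichlet_kernel k x y))
      = (\<Sum>k=M m N + 1..n. h x)"
    using assms by (intro sum.cong refl avg_dirichlet_kernel_between) auto
  finally show ?thesis by simp
qed

lemma fejer_op_add: "fejer_op J n (\<lambda>y. h y + h' y) x = fejer_op J n h x + fejer_op J n h' x"
  by (simp add: fejer_op_def distrib_right avg_add)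

subsection \<open>Quasi-norm estimates\<close>

text \<open>Chosen so that the induction over levels closes, see \<open>kernel_const_step\<close>.
  The denominator is positive for \<open>0 < p\<close>.\<close>

definition kernel_const :: "real \<Rightarrow> real" where
  "kernel_const p = real B powr (2 * p + 1) / (2 powr p - 1)"

definition fejer_const :: "real \<Rightarrow> real" where
  "fejer_const p = (2 * real B ^ 2) powr p + real B powr p * kernel_const p"

text \<open>Up to a constant, summand \<open>A\<close> bounds the contribution of level
  \<open>A\<close> to the integral of the \<open>p\<close>-th power of the Fejer kernel.\<close>

definition level_sum :: "real \<Rightarrow> nat \<Rightarrow> real" where
  "level_sum p J = (\<Sum>A\<le>J. real (M m A) powr (2 * p - 1))"

lemma B_ge: "2 \<le> B"
  using m_ge[of 0] m_le[of 0] by simp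

lemma two_powr_gt_1: "0 < p \<Longrightarrow> 1 < (2::real) powr p"
  by (simp add: gr_one_powr)

lemma kernel_const_ge_1:
  assumes "0 < p" "p \<le> 1"
  shows "1 \<le> kernel_const p"
proof -
  have "2 powr p \<le> (2::real) powr 1" using assms by (intro powr_mono) auto
  moreover have "1 \<le> real B powr (2 * p + 1)" using B_ge assms by (intro ge_one_powr_ge_zero) auto
  ultimately show ?thesis using two_powr_gt_1[OF assms(1)] by (simp add: kernel_const_def)
qed

text \<open>With \<open>c = m A\<close>, the difference of \<open>c powr (2 * p - 1)\<close> and
  \<open>c powr p / c\<close> is \<open>c powr p / c * (c powr p - 1)\<close>. This is at least
  \<open>(2 powr p - 1) / B\<close>, and \<open>kernel_const p\<close> times that lower bound is
  exactly \<open>B powr (2 * p)\<close>.\<close>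

lemma kernel_const_step:
  assumes "0 < p" "p \<le> 1"
  shows "(real B ^ 2) powr p + real (m A) powr p / real (m A) * kernel_const p
    \<le> kernel_const p * real (m A) powr (2 * p - 1)"
proof -
  define c where "c = real (m A)"
  have c: "2 \<le> c" "c \<le> real B" using m_ge m_le by (simp_all add: c_def)
  have K: "0 < kernel_const p" using kernel_const_ge_1[OF assms] by simp
  have c2: "2 powr p \<le> c powr p" using c assms by (intro powr_mono2) auto
  have p2: "1 < (2::real) powr p" by (rule two_powr_gt_1[OF assms(1)])
  have "(real B ^ 2) powr p = real B powr (2 * p)"
    using B_ge by (simp add: powr_powr flip: powr_numeral)
  also have "\<dots> = kernel_const p * (1 / real B * (2 powr p - 1))"
    using B_ge p2 assms by (simp add: kernel_const_def powr_add)
  also have "\<dots> \<le> kernel_const p * (c powr p / c * (c powr p - 1))"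
  proof (intro mult_left_mono mult_mono)
    show "1 / real B \<le> c powr p / c" using c c2 p2 by (intro frac_le) auto
  qed (use c2 p2 c K in auto)
  also have "\<dots> = kernel_const p * c powr (2 * p - 1) - c powr p / c * kernel_const p"
  proof -
    have "c powr (2 * p - 1) = c powr p * c powr p / c"
      using c by (simp add: powr_diff flip: powr_add)
    then show ?thesis by (simp add: algebra_simps diff_divide_distrib)
  qed
  finally show ?thesis by (simp add: c_def)
qed

section \<open>Size of the kernels in the \<open>L_p\<close> quasi-norm\<close>

lemma avg_dirichlet_kernel_powr:
  assumes "y \<in> vil_space m" "0 < p"
  shows "avg A (\<lambda>x. (real (M m A) * norm (dirichlet_kernel (M m A) x y)) powr p)
     = real (M m A) powr (2 * p - 1)"
proof -
  have "avg A (\<lambda>x. (real (M m A) * norm (dirichlet_kernel (M m A) x y)) powr p)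
      = avg A (\<lambda>x. if \<forall>j<A. x j = y j then (real (M m A) * real (M m A)) powr p else 0)"
  proof (rule avg_cong)
    fix x assume "x \<in> vil_space m"
    from dirichlet_kernel_M[OF this assms(1), of A]
    show "(real (M m A) * norm (dirichlet_kernel (M m A) x y)) powr p
       = (if \<forall>j<A. x j = y j then (real (M m A) * real (M m A)) powr p else 0)"
      by auto
  qed
  also have "\<dots> = (real (M m A) * real (M m A)) powr p / real (M m A)"
    by (simp add: avg_atom[OF assms(1)])
  also have "\<dots> = real (M m A) powr (2 * p - 1)"
    using M_pos[of A] by (simp add: powr_mult powr_diff flip: powr_add)
  finally show ?thesis .
qed

text \<open>In passing from level \<open>A\<close> to the next, the full geometric sum multiplies
  the old kernel by \<open>m A\<close> but confines it to \<open>x A = y A\<close>, a set of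
  relative measure \<open>1 / m A\<close>; this yields the factor \<open>m A powr p / m A\<close>.
  The Dirichlet part is added, and \<open>kernel_const_step\<close> absorbs both.\<close>

lemma avg_fejer_kernel_M_powr_le:
  assumes "y \<in> vil_space m" "0 < p" "p \<le> 1"
  shows "avg A (\<lambda>x. norm (fejer_kernel (M m A) x y) powr p) \<le> kernel_const p * real (M m A) powr (2 * p - 1)"
proof (induction A)
  case 0
  then show ?case
    using kernel_const_ge_1[OF assms(2,3)]
    by (simp add: avg_def fejer_kernel_def dirichlet_kernel_def psi_def)
next
  case (Suc A)
  define D where "D x = (real (M m A) * norm (dirichlet_kernel (M m A) x y)) powr p" for x
  define F where "F x = norm (fejer_kernel (M m A) x y) powr p" for x
  have depD: "depends A D" unfolding D_def
    by (rule depends_comp[OF depends_dirichlet_kernel(1)[OF order_refl]])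
  have depF: "depends A F" unfolding F_def
    by (rule depends_comp[OF depends_fejer_kernel[OF order_refl]])
  have yA: "y A < m A" using assms(1) by (simp add: vil_space_def)
  have pt: "norm (fejer_kernel (M m (Suc A)) x y) powr p
      \<le> (real B ^ 2) powr p * D x + real (m A) powr p * (if x A = y A then F x else 0)"
    if x: "x \<in> vil_space m" for x
  proof -
    have "norm (fejer_kernel (M m (Suc A)) x y) powr p
        \<le> (real B ^ 2 * (real (M m A) * norm (dirichlet_kernel (M m A) x y))
          + norm (ratio_sum (m A) A x y) * norm (fejer_kernel (M m A) x y)) powr p"
      unfolding M_Suc[of A] using assms by (intro powr_mono2 norm_fejer_kernel_mult_le) auto
    also have "\<dots> \<le> (real B ^ 2 * (real (M m A) * norm (dirichlet_kernel (M m A) x y))) powr p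
          + (norm (ratio_sum (m A) A x y) * norm (fejer_kernel (M m A) x y)) powr p"
      using assms by (intro powr_add_le_powr_add_powr) auto
    also have "\<dots> = (real B ^ 2) powr p * D x + real (m A) powr p * (if x A = y A then F x else 0)"
      by (simp add: ratio_sum_full[OF x assms(1)] D_def F_def powr_mult)
    finally show ?thesis .
  qed
  have "avg (Suc A) (\<lambda>x. norm (fejer_kernel (M m (Suc A)) x y) powr p)
      \<le> (real B ^ 2) powr p * avg (Suc A) D
        + real (m A) powr p * avg (Suc A) (\<lambda>x. if x A = y A then F x else 0)"
    using avg_mono[OF pt] by (simp add: avg_add avg_cmult)
  also have "avg (Suc A) (\<lambda>x. if x A = y A then F x else 0) = avg A F / real (m A)"
    by (rule avg_restrict_coordinate[OF depF yA])
  also have "avg (Suc A) D = real (M m A) powr (2 * p - 1)"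
    using avg_Suc[OF depD] avg_dirichlet_kernel_powr[OF assms(1,2)] by (simp add: D_def [abs_def])
  also have "(real B ^ 2) powr p * real (M m A) powr (2 * p - 1) + real (m A) powr p * (avg A F / real (m A))
      \<le> (real B ^ 2) powr p * real (M m A) powr (2 * p - 1)
        + real (m A) powr p * (kernel_const p * real (M m A) powr (2 * p - 1) / real (m A))"
    using Suc by (intro add_mono mult_left_mono divide_right_mono) (auto simp: F_def [abs_def])
  also have "\<dots> = ((real B ^ 2) powr p + real (m A) powr p / real (m A) * kernel_const p)
        * real (M m A) powr (2 * p - 1)"
    by (simp add: algebra_simps)
  also have "\<dots> \<le> (kernel_const p * real (m A) powr (2 * p - 1)) * real (M m A) powr (2 * p - 1)"
    by (intro mult_right_mono kernel_const_step assms) auto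
  also have "\<dots> = kernel_const p * real (M m (Suc A)) powr (2 * p - 1)"
    by (simp add: M_Suc powr_mult)
  finally show ?case .
qed

lemma avg_fejer_kernel_powr_le:
  assumes "y \<in> vil_space m" "0 < p" "p \<le> 1" "n \<le> M m J"
  shows "avg J (\<lambda>x. norm (fejer_kernel n x y) powr p) \<le> fejer_const p * level_sum p J"
proof -
  define D where "D A x = (real (M m A) * norm (dirichlet_kernel (M m A) x y)) powr p" for A x
  define F where "F A x = norm (fejer_kernel (M m A) x y) powr p" for A x
  have depD: "depends A (D A)" for A unfolding D_def
    by (rule depends_comp[OF depends_dirichlet_kernel(1)[OF order_refl]])
  have depF: "depends A (F A)" for A unfolding F_def
    by (rule depends_comp[OF depends_fejer_kernel[OF order_refl]])
  \<comment> \<open>\<open>norm_fejer_kernel_le\<close> asks for a strict bound while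
    \<open>n = M m J\<close> is allowed, hence one more level and a sum over
    \<open>A \<le> J\<close>.\<close>
  have "M m J < M m (Suc J)"
    using M_pos[of J] m_ge[of J] by (simp add: M_Suc)
  then have n: "n < M m (Suc J)" using assms(4) by simp
  have pt: "norm (fejer_kernel n x y) powr p
      \<le> (\<Sum>A\<le>J. (2 * real B ^ 2) powr p * D A x + real B powr p * F A x)" for x
  proof -
    have "norm (fejer_kernel n x y) powr p
      \<le> (\<Sum>A<Suc J. 2 * real B ^ 2 * (real (M m A) * norm (dirichlet_kernel (M m A) x y))
          + real B * norm (fejer_kernel (M m A) x y)) powr p"
      using assms n by (intro powr_mono2 norm_fejer_kernel_le) auto
    also have "\<dots> \<le> (\<Sum>A<Suc J. (2 * real B ^ 2 * (real (M m A) * norm (dirichlet_kernel (M m A) x y))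
          + real B * norm (fejer_kernel (M m A) x y)) powr p)"
      using assms by (intro powr_sum_le_sum_powr) auto
    also have "\<dots> \<le> (\<Sum>A<Suc J. (2 * real B ^ 2) powr p * D A x + real B powr p * F A x)"
    proof (rule sum_mono)
      fix A
      have "(2 * real B ^ 2 * (real (M m A) * norm (dirichlet_kernel (M m A) x y))
          + real B * norm (fejer_kernel (M m A) x y)) powr p
        \<le> (2 * real B ^ 2 * (real (M m A) * norm (dirichlet_kernel (M m A) x y))) powr p
          + (real B * norm (fejer_kernel (M m A) x y)) powr p"
        using assms by (intro powr_add_le_powr_add_powr) auto
      then show "(2 * real B ^ 2 * (real (M m A) * norm (dirichlet_kernel (M m A) x y))
          + real B * norm (fejer_kernel (M m A) x y)) powr p
        \<le> (2 * real B ^ 2) powr p * D A x + real B powr p * F A x"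
        by (simp add: D_def F_def powr_mult)
    qed
    finally show ?thesis by (simp add: lessThan_Suc_atMost)
  qed
  have "avg J (\<lambda>x. norm (fejer_kernel n x y) powr p)
      \<le> (\<Sum>A\<le>J. (2 * real B ^ 2) powr p * avg J (D A) + real B powr p * avg J (F A))"
    using avg_mono[of _ _ J, OF pt] by (simp add: avg_sum avg_add avg_cmult)
  also have "\<dots> \<le> (\<Sum>A\<le>J. fejer_const p * real (M m A) powr (2 * p - 1))"
  proof (rule sum_mono)
    fix A assume "A \<in> {..J}"
    then have A: "A \<le> J" by simp
    have "avg J (D A) = real (M m A) powr (2 * p - 1)"
      using avg_level[OF depD A] avg_dirichlet_kernel_powr[OF assms(1,2)] by (simp add: D_def [abs_def])
    moreover have "avg J (F A) \<le> kernel_const p * real (M m A) powr (2 * p - 1)"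
      using avg_level[OF depF A] avg_fejer_kernel_M_powr_le[OF assms(1,2,3), of A] by (simp add: F_def [abs_def])
    then have "real B powr p * avg J (F A) \<le> real B powr p * (kernel_const p * real (M m A) powr (2 * p - 1))"
      by (intro mult_left_mono) auto
    ultimately show "(2 * real B ^ 2) powr p * avg J (D A) + real B powr p * avg J (F A)
        \<le> fejer_const p * real (M m A) powr (2 * p - 1)"
      by (simp add: fejer_const_def algebra_simps)
  qed
  also have "\<dots> = fejer_const p * level_sum p J" by (simp add: level_sum_def sum_distrib_left)
  finally show ?thesis .
qed

text \<open>Subadditivity moves the \<open>p\<close>-th power inside the sum over representatives,
  and the kernel bound is uniform in the second point. The power \<open>1 - p\<close> combines
  \<open>(1 / M m J) powr p\<close> with the factor \<open>M m J\<close> from turning the sum of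
  \<open>norm (h (digit m a)) powr p\<close> into an average.\<close>

lemma avg_fejer_op_powr_le:
  assumes "0 < p" "p \<le> 1" "n \<le> M m J"
  shows "avg J (\<lambda>x. norm (fejer_op J n h x) powr p)
    \<le> real (M m J) powr (1 - p) * (fejer_const p * level_sum p J) * avg J (\<lambda>x. norm (h x) powr p)"
proof -
  define Mr where "Mr = real (M m J)"
  have Mr: "0 < Mr" using M_pos by (simp add: Mr_def)
  define U where "U = fejer_const p * level_sum p J"
  have pt: "norm (fejer_op J n h x) powr p
      \<le> (\<Sum>a<M m J. (Mr powr (- p) * norm (h (digit m a)) powr p) * norm (fejer_kernel n x (digit m a)) powr p)" for x
  proof -
    have "norm (fejer_op J n h x) \<le> (\<Sum>a<M m J. norm (h (digit m a)) * norm (fejer_kernel n x (digit m a)) / Mr)"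
      unfolding fejer_op_def avg_def sum_divide_distrib
      by (rule order_trans[OF norm_sum]) (simp add: norm_mult norm_divide Mr_def)
    then have "norm (fejer_op J n h x) powr p
        \<le> (\<Sum>a<M m J. norm (h (digit m a)) * norm (fejer_kernel n x (digit m a)) / Mr) powr p"
      using assms by (intro powr_mono2) auto
    also have "\<dots> \<le> (\<Sum>a<M m J. (norm (h (digit m a)) * norm (fejer_kernel n x (digit m a)) / Mr) powr p)"
      using assms Mr by (intro powr_sum_le_sum_powr) auto
    also have "\<dots> = (\<Sum>a<M m J. (Mr powr (- p) * norm (h (digit m a)) powr p) * norm (fejer_kernel n x (digit m a)) powr p)"
      using Mr by (intro sum.cong refl) (simp add: powr_divide powr_mult powr_minus field_simps)
    finally show ?thesis .
  qed
  have "avg J (\<lambda>x. norm (fejer_op J n h x) powr p)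
      \<le> (\<Sum>a<M m J. (Mr powr (- p) * norm (h (digit m a)) powr p) * avg J (\<lambda>x. norm (fejer_kernel n x (digit m a)) powr p))"
    using avg_mono[of _ _ J, OF pt] by (simp add: avg_sum avg_cmult)
  also have "\<dots> \<le> (\<Sum>a<M m J. (Mr powr (- p) * norm (h (digit m a)) powr p) * U)"
    unfolding U_def using assms
    by (intro sum_mono mult_left_mono avg_fejer_kernel_powr_le) (auto simp: digit_in_space)
  also have "\<dots> = Mr powr (1 - p) * U * avg J (\<lambda>x. norm (h x) powr p)"
  proof -
    have "Mr powr (1 - p) = Mr * Mr powr (- p)"
      using Mr powr_add[of Mr 1 "- p"] by simp
    then show ?thesis
      using Mr by (simp add: avg_def Mr_def [symmetric] sum_distrib_left sum_distrib_right sum_divide_distrib mult_ac)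
  qed
  finally show ?thesis by (simp add: U_def Mr_def)
qed

lemma depends_fejer_op:
  assumes "n \<le> M m J"
  shows "depends J (fejer_op J n h)"
proof (rule dependsI)
  fix x x' assume *: "x \<in> vil_space m" "x' \<in> vil_space m" "\<forall>j<J. x j = x' j"
  have "fejer_kernel n x y = fejer_kernel n x' y" for y
    by (rule dependsD[OF depends_fejer_kernel[OF assms] *])
  then show "fejer_op J n h x = fejer_op J n h x'" by (simp add: fejer_op_def)
qed

lemma level_sum_nonneg: "0 \<le> level_sum p J"
  by (simp add: level_sum_def sum_nonneg)

lemma fejer_const_nonneg: "0 < p \<Longrightarrow> p \<le> 1 \<Longrightarrow> 0 \<le> fejer_const p"
  using kernel_const_ge_1[of p] by (simp add: fejer_const_def)

section \<open>Distance of the Fejer means to the martingale terms\<close>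

definition increment :: "real \<Rightarrow> (nat \<Rightarrow> (nat \<Rightarrow> nat) \<Rightarrow> complex) \<Rightarrow> nat \<Rightarrow> real" where
  "increment p f N = avg (Suc N) (\<lambda>x. norm (f (Suc N) x - f N x) powr p)"

text \<open>The share of the martingale increment in \<open>fejer_dist_le\<close>: the bound of
  \<open>avg_fejer_op_powr_le\<close> at level \<open>Suc N\<close> is divided by
  \<open>n powr p\<close>, and \<open>M m (Suc N) \<le> B * n\<close> turns this into the exponent
  \<open>1 - 2 * p\<close> and the factor \<open>B powr p\<close>.\<close>

definition increment_bound :: "real \<Rightarrow> (nat \<Rightarrow> (nat \<Rightarrow> nat) \<Rightarrow> complex) \<Rightarrow> nat \<Rightarrow> real" where
  "increment_bound p f N = real B powr p * fejer_const p *
     (real (M m (Suc N)) powr (1 - 2 * p) * level_sum p (Suc N) * increment p f N)"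

definition fejer_defect :: "real \<Rightarrow> (nat \<Rightarrow> (nat \<Rightarrow> nat) \<Rightarrow> complex) \<Rightarrow> nat \<Rightarrow> real" where
  "fejer_defect p f N = avg N (\<lambda>x. norm (fejer m f (M m N) x - f N x) powr p)"

lemma increment_nonneg: "0 \<le> increment p f N"
  by (simp add: increment_def avg_nonneg)

lemma depends_fejer:
  assumes "vil_martingale m f" "n \<le> M m J"
  shows "depends J (fejer m f n)"
proof -
  have "fejer m f n = (\<lambda>x. fejer_op J n (f J) x / of_nat n)"
    by (rule ext) (rule fejer_martingale[OF assms])
  then show ?thesis by (simp add: depends_comp[OF depends_fejer_op[OF assms(2)], where F = "\<lambda>z. z / of_nat n"])
qed

lemma fejer_dist_le:
  assumes f: "vil_martingale m f" and p: "0 < p" "p \<le> 1" and n: "M m N \<le> n" "n \<le> M m (Suc N)"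
  shows "avg (Suc N) (\<lambda>x. norm (fejer m f n x - f N x) powr p)
    \<le> increment_bound p f N + (real (M m N) / real n) powr p * fejer_defect p f N"
proof -
  define d where "d x = f (Suc N) x - f N x" for x
  define e where "e x = fejer m f (M m N) x - f N x" for x
  have n0: "0 < n" using n M_pos[of N] by simp
  have M0: "0 < real (M m N)" using M_pos by simp
  have depf: "depends N (f N)" by (rule martingale_depends[OF f])
  have depe: "depends N (\<lambda>x. norm (e x) powr p)" unfolding e_def
    by (rule depends_comp2[OF depends_fejer[OF f order_refl] depf])
  \<comment> \<open>Split \<open>f (Suc N)\<close> into \<open>d\<close> and \<open>f N\<close>. On
    \<open>f N\<close> the operator yields \<open>n - M m N\<close> copies of \<open>f N x\<close>
    and \<open>M m N\<close> copies of \<open>e x + f N x\<close>, so there are \<open>n\<close>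
    copies of \<open>f N x\<close> in all, which cancel after division by \<open>n\<close>.\<close>
  have eq: "fejer m f n x - f N x = fejer_op (Suc N) n d x / of_nat n + of_real (real (M m N) / real n) * e x"
    if x: "x \<in> vil_space m" for x
  proof -
    have "fejer_op (Suc N) n (f (Suc N)) x = fejer_op (Suc N) n (\<lambda>y. d y + f N y) x"
      by (simp add: d_def)
    also have "\<dots> = fejer_op (Suc N) n d x + (of_nat (n - M m N) * f N x + fejer_op N (M m N) (f N) x)"
      by (simp only: fejer_op_add fejer_op_between[OF depf n x])
    also have "fejer_op N (M m N) (f N) x = of_nat (M m N) * (e x + f N x)"
      using M0 by (simp add: e_def fejer_martingale[OF f order_refl])
    finally have "fejer_op (Suc N) n (f (Suc N)) x
        = fejer_op (Suc N) n d x + of_nat (M m N) * e x + of_nat n * f N x"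
      using n by (simp add: of_nat_diff algebra_simps)
    then show ?thesis
      using n0 by (simp add: fejer_martingale[OF f n(2)] add_divide_distrib)
  qed
  have pt: "norm (fejer m f n x - f N x) powr p
     \<le> real n powr (- p) * norm (fejer_op (Suc N) n d x) powr p + (real (M m N) / real n) powr p * norm (e x) powr p"
    if x: "x \<in> vil_space m" for x
  proof -
    have "norm (fejer m f n x - f N x) powr p \<le> norm (fejer_op (Suc N) n d x / of_nat n) powr p
        + norm (of_real (real (M m N) / real n) * e x) powr p"
      unfolding eq[OF x] by (rule norm_add_powr_le[OF p])
    also have "norm (fejer_op (Suc N) n d x / of_nat n) powr p = real n powr (- p) * norm (fejer_op (Suc N) n d x) powr p"
      using n0 by (simp add: norm_divide powr_divide powr_minus field_simps)
    also have "norm (of_real (real (M m N) / real n) * e x) powr p = (real (M m N) / real n) powr p * norm (e x) powr p"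
      by (simp add: norm_mult norm_divide powr_mult powr_divide)
    finally show ?thesis .
  qed
  have "avg (Suc N) (\<lambda>x. norm (fejer m f n x - f N x) powr p)
     \<le> real n powr (- p) * avg (Suc N) (\<lambda>x. norm (fejer_op (Suc N) n d x) powr p)
       + (real (M m N) / real n) powr p * avg (Suc N) (\<lambda>x. norm (e x) powr p)"
    using avg_mono[of _ _ "Suc N", OF pt] by (simp add: avg_add avg_cmult)
  also have "avg (Suc N) (\<lambda>x. norm (e x) powr p) = fejer_defect p f N"
    unfolding fejer_defect_def e_def [symmetric] by (rule avg_Suc[OF depe])
  also have "real n powr (- p) * avg (Suc N) (\<lambda>x. norm (fejer_op (Suc N) n d x) powr p) \<le> increment_bound p f N"
  proof -
    define R where "R = real (M m (Suc N))"
    have R: "0 < R" using M_pos by (simp add: R_def)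
    have X: "0 \<le> R powr (1 - p) * (fejer_const p * level_sum p (Suc N)) * increment p f N"
      using fejer_const_nonneg[OF p] level_sum_nonneg increment_nonneg by simp
    have "R \<le> real B * real (M m N)" using m_le[of N] by (simp add: R_def M_Suc mult_right_mono)
    also have "\<dots> \<le> real B * real n" using n by (intro mult_left_mono) auto
    finally have "R powr p \<le> real B powr p * real n powr p"
      using p R by (metis powr_mono2 powr_mult less_eq_real_def)
    then have np: "real n powr (- p) \<le> real B powr p * R powr (- p)"
      using n0 R by (simp add: powr_minus field_simps)
    have "real n powr (- p) * avg (Suc N) (\<lambda>x. norm (fejer_op (Suc N) n d x) powr p)
        \<le> real n powr (- p) * (R powr (1 - p) * (fejer_const p * level_sum p (Suc N)) * increment p f N)"
      unfolding increment_def R_def d_def [symmetric]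
      by (intro mult_left_mono avg_fejer_op_powr_le p n) auto
    also have "\<dots> \<le> (real B powr p * R powr (- p)) * (R powr (1 - p) * (fejer_const p * level_sum p (Suc N)) * increment p f N)"
      by (rule mult_right_mono[OF np X])
    also have "\<dots> = increment_bound p f N"
    proof -
      have "R powr (1 - 2 * p) = R powr (- p) * R powr (1 - p)"
        by (simp flip: powr_add)
      then show ?thesis by (simp add: increment_bound_def R_def [symmetric] mult_ac)
    qed
    finally show ?thesis .
  qed
  finally show ?thesis by simp
qed

lemma fejer_defect_nonneg: "0 \<le> fejer_defect p f N"
  by (simp add: fejer_defect_def avg_nonneg)

text \<open>The case \<open>n = M m (Suc N)\<close> of \<open>fejer_dist_le\<close>, where
  \<open>M m N / n = 1 / m N \<le> 1 / 2\<close>. Replacing \<open>f N\<close> by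
  \<open>f (Suc N)\<close> costs one increment.\<close>

lemma fejer_defect_Suc_le:
  assumes f: "vil_martingale m f" and p: "0 < p" "p \<le> 1"
  shows "fejer_defect p f (Suc N)
    \<le> (increment_bound p f N + increment p f N) + (1 / 2) powr p * fejer_defect p f N"
proof -
  have "fejer_defect p f (Suc N) \<le> avg (Suc N) (\<lambda>x. norm (fejer m f (M m (Suc N)) x - f N x) powr p
      + norm (f (Suc N) x - f N x) powr p)"
    unfolding fejer_defect_def
  proof (rule avg_mono)
    fix x
    show "norm (fejer m f (M m (Suc N)) x - f (Suc N) x) powr p
      \<le> norm (fejer m f (M m (Suc N)) x - f N x) powr p + norm (f (Suc N) x - f N x) powr p"
      using norm_add_powr_le[OF p, of "fejer m f (M m (Suc N)) x - f N x" "f N x - f (Suc N) x"]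
      by (simp add: norm_minus_commute)
  qed
  also have "\<dots> \<le> increment_bound p f N + (real (M m N) / real (M m (Suc N))) powr p * fejer_defect p f N
      + increment p f N"
    unfolding avg_add increment_def[symmetric]
    by (intro add_mono fejer_dist_le f p M_mono) auto
  also have "(real (M m N) / real (M m (Suc N))) powr p * fejer_defect p f N \<le> (1 / 2) powr p * fejer_defect p f N"
    using M_pos[of N] m_ge[of N] p
    by (intro mult_right_mono powr_mono2 fejer_defect_nonneg) (auto simp: M_Suc field_simps)
  finally show ?thesis by simp
qed

lemma fejer_defect_tendsto_0:
  assumes f: "vil_martingale m f" and p: "0 < p" "p \<le> 1"
    and "increment_bound p f \<longlonglongrightarrow> 0" "increment p f \<longlonglongrightarrow> 0"
  shows "fejer_defect p f \<longlonglongrightarrow> 0"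
proof (rule tendsto_zero_of_contraction_recurrence)
  show "(\<lambda>N. increment_bound p f N + increment p f N) \<longlonglongrightarrow> 0"
    using tendsto_add[OF assms(4,5)] by simp
  show "(1 / 2) powr p < (1::real)" using p powr_less_mono2[of p "1 / 2" 1] by simp
qed (auto simp: fejer_defect_nonneg fejer_defect_Suc_le[OF f p])

subsection \<open>Convergence\<close>

text \<open>The \<open>p\<close>-th power of the maximal function of \<open>f\<close> minus its
  partial sum of order \<open>M m N\<close>: the martingale generated by that partial sum is
  \<open>f (min k N)\<close>, see \<open>condexp_partial_sum\<close>.\<close>

definition tail_max :: "real \<Rightarrow> (nat \<Rightarrow> (nat \<Rightarrow> nat) \<Rightarrow> complex) \<Rightarrow> nat \<Rightarrow> (nat \<Rightarrow> nat) \<Rightarrow> ennreal" where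
  "tail_max p f N x = (SUP k. ennreal (norm (f k x - f (min k N) x) powr p))"

definition tail_int :: "real \<Rightarrow> (nat \<Rightarrow> (nat \<Rightarrow> nat) \<Rightarrow> complex) \<Rightarrow> nat \<Rightarrow> ennreal" where
  "tail_int p f N = (\<integral>\<^sup>+ x. tail_max p f N x \<partial>vil_mu m)"

lemma measurable_martingale [measurable]:
  "vil_martingale m f \<Longrightarrow> f n \<in> borel_measurable (vil_mu m)"
  by (rule measurable_depends[OF martingale_depends])

lemma measurable_tail_max:
  assumes [measurable]: "vil_martingale m f"
  shows "tail_max p f N \<in> borel_measurable (vil_mu m)"
  unfolding tail_max_def by measurable

lemma condexp_cong:
  assumes "\<And>x. x \<in> vil_space m \<Longrightarrow> h x = h' x"
  shows "condexp_n m k h x = condexp_n m k h' x"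
proof -
  have "(\<integral>y\<in>I_n m k x. h y \<partial>vil_mu m) = (\<integral>y\<in>I_n m k x. h' y \<partial>vil_mu m)"
    unfolding set_lebesgue_integral_def
    by (rule Bochner_Integration.integral_cong) (auto simp: space_vil_mu assms)
  then show ?thesis by (simp add: condexp_n_def)
qed

lemma condexp_partial_sum:
  assumes "vil_martingale m f" "x \<in> vil_space m"
  shows "condexp_n m k (partial_sum m f (M m N)) x = f (min k N) x"
proof -
  have "condexp_n m k (partial_sum m f (M m N)) x = condexp_n m k (f N) x"
    by (rule condexp_cong) (rule partial_sum_M[OF assms(1)])
  also have "\<dots> = f (min k N) x"
  proof (cases "k \<le> N")
    case True
    then show ?thesis by (simp add: condexp_martingale[OF assms(1) True assms(2)])
  next
    case False
    then have "depends k (f N)" by (intro depends_mono[OF martingale_depends[OF assms(1)]]) simp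
    with False show ?thesis by (simp add: condexp_depends assms)
  qed
  finally show ?thesis .
qed

lemma maxfun_int_tail:
  assumes "vil_martingale m f"
  shows "maxfun_int m p (\<lambda>k x. f k x - condexp_n m k (partial_sum m f (M m N)) x) = tail_int p f N"
  unfolding maxfun_int_def tail_int_def tail_max_def
  by (intro nn_integral_cong) (simp add: space_vil_mu condexp_partial_sum[OF assms])

text \<open>Finiteness matters because \<open>Hp_norm\<close> uses \<open>enn2real\<close>, which
  sends infinity to 0; only with it does the modulus control the tail. Pointwise the tail is at most
  twice the \<open>p\<close>-th power of the maximal function of \<open>f\<close>.\<close>

lemma tail_int_finite:
  assumes "in_Hp m p f" "0 < p" "p \<le> 1"
  shows "tail_int p f N < \<infinity>"
proof -
  have f: "vil_martingale m f" and fin: "maxfun_int m p f < \<infinity>"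
    using assms(1) by (auto simp: in_Hp_def)
  note [measurable] = f
  define S where "S x = (SUP n. ennreal (norm (f n x) powr p))" for x
  have [measurable]: "S \<in> borel_measurable (vil_mu m)" unfolding S_def by measurable
  have "tail_max p f N x \<le> S x + S x" for x
    unfolding tail_max_def
  proof (rule SUP_least)
    fix k
    have "norm (f k x - f (min k N) x) powr p \<le> norm (f k x) powr p + norm (f (min k N) x) powr p"
      using norm_add_powr_le[OF assms(2,3), of "f k x" "- f (min k N) x"] by simp
    then have "ennreal (norm (f k x - f (min k N) x) powr p)
        \<le> ennreal (norm (f k x) powr p) + ennreal (norm (f (min k N) x) powr p)"
      by (simp flip: ennreal_plus)
    also have "\<dots> \<le> S x + S x" unfolding S_def by (intro add_mono SUP_upper) auto
    finally show "ennreal (norm (f k x - f (min k N) x) powr p) \<le> S x + S x" .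
  qed
  then have "tail_int p f N \<le> (\<integral>\<^sup>+ x. S x + S x \<partial>vil_mu m)"
    unfolding tail_int_def by (intro nn_integral_mono)
  also have "\<dots> = maxfun_int m p f + maxfun_int m p f"
    by (simp add: nn_integral_add maxfun_int_def S_def [symmetric])
  also have "\<dots> < \<infinity>" using fin by simp
  finally show ?thesis .
qed

lemma modulus_powr:
  assumes "in_Hp m p f" "0 < p"
  shows "modulus m p f N powr p = enn2real (tail_int p f N)"
  using assms by (simp add: modulus_def Hp_norm_def maxfun_int_tail in_Hp_def powr_powr)

lemma tail_max_ge:
  assumes "N \<le> k"
  shows "ennreal (norm (f k x - f N x) powr p) \<le> tail_max p f N x"
  using SUP_upper[of k UNIV "\<lambda>k. ennreal (norm (f k x - f (min k N) x) powr p)"] assms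
  by (simp add: tail_max_def min_absorb2)

lemma increment_le_tail_int:
  assumes f: "vil_martingale m f"
  shows "ennreal (increment p f N) \<le> tail_int p f N"
proof -
  have "depends (Suc N) (\<lambda>x. norm (f (Suc N) x - f N x) powr p)"
    by (rule depends_comp2[OF martingale_depends[OF f] depends_mono[OF martingale_depends[OF f]]]) simp
  then have "ennreal (increment p f N) = (\<integral>\<^sup>+ x. ennreal (norm (f (Suc N) x - f N x) powr p) \<partial>vil_mu m)"
    by (simp add: increment_def nn_integral_depends)
  also have "\<dots> \<le> tail_int p f N"
    unfolding tail_int_def by (intro nn_integral_mono tail_max_ge) simp
  finally show ?thesis .
qed

lemma two_power_le_M: "2 ^ A \<le> M m A"
proof (induction A)
  case (Suc A)
  then show ?case using m_ge[of A] mult_le_mono[of 2 "m A" "2 ^ A" "M m A"] by (simp add: M_Suc)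
qed simp

text \<open>Explains the power of \<open>N\<close> in the hypothesis. For \<open>p = 1 / 2\<close>
  every summand is 1 and the floor is 1, so \<open>(N ^ 2) powr p = N\<close> matches the number of
  levels. For \<open>p < 1 / 2\<close> the floor is 0 and \<open>2 ^ A \<le> M m A\<close> gives a
  convergent geometric series.\<close>

lemma level_sum_le:
  assumes "0 < p" "p \<le> 1 / 2"
  obtains K where "0 \<le> K"
    "\<And>N. 1 \<le> N \<Longrightarrow> level_sum p (Suc N) \<le> K * (real N ^ (2 * nat \<lfloor>1/2 + p\<rfloor>)) powr p"
proof (cases "p = 1 / 2")
  case True
  \<comment> \<open>There are \<open>N + 2\<close> summands, which is at most \<open>3 * N\<close>
    for \<open>1 \<le> N\<close>.\<close>
  have "level_sum p (Suc N) \<le> 3 * (real N ^ (2 * nat \<lfloor>1/2 + p\<rfloor>)) powr p" if "1 \<le> N" for N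
  proof -
    have "2 * p - 1 = 0" using True by simp
    then have "real (M m A) powr (2 * p - 1) = 1" for A using M_pos[of A] by simp
    then have "level_sum p (Suc N) = real N + 2" by (simp add: level_sum_def)
    moreover have "(real N ^ (2 * nat \<lfloor>1/2 + p\<rfloor>)) powr p = real N"
      unfolding True using that by (simp add: powr_half_sqrt)
    ultimately show ?thesis using that by simp
  qed
  then show ?thesis using that[of 3] by simp
next
  case False
  define \<theta> where "\<theta> = (2::real) powr (2 * p - 1)"
  have \<theta>: "0 < \<theta>" "\<theta> < 1"
    using powr_less_mono[of "2 * p - 1" 0 2] False assms by (auto simp: \<theta>_def)
  have "level_sum p (Suc N) \<le> 1 / (1 - \<theta>) * (real N ^ (2 * nat \<lfloor>1/2 + p\<rfloor>)) powr p" for N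
  proof -
    have "level_sum p (Suc N) \<le> (\<Sum>A\<le>Suc N. \<theta> ^ A)"
      unfolding level_sum_def
    proof (rule sum_mono)
      fix A
      have "real (M m A) powr (2 * p - 1) \<le> (2 ^ A) powr (2 * p - 1)"
        using two_power_le_M[of A] assms by (intro powr_mono2') (auto simp flip: of_nat_power)
      also have "\<dots> = \<theta> ^ A" by (simp add: \<theta>_def powr_powr mult.commute flip: powr_realpow)
      finally show "real (M m A) powr (2 * p - 1) \<le> \<theta> ^ A" .
    qed
    also have "\<dots> \<le> (\<Sum>A. \<theta> ^ A)"
      using \<theta> by (intro sum_le_suminf summable_geometric) auto
    also have "\<dots> = 1 / (1 - \<theta>)" using \<theta> by (intro suminf_geometric) auto
    also have "\<dots> = 1 / (1 - \<theta>) * (real N ^ (2 * nat \<lfloor>1/2 + p\<rfloor>)) powr p"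
    proof -
      have "\<lfloor>1/2 + p\<rfloor> = 0" using False assms by (simp add: floor_eq_iff)
      then show ?thesis by simp
    qed
    finally show ?thesis .
  qed
  then show ?thesis using that[of "1 / (1 - \<theta>)"] \<theta> by simp
qed

lemma ex_level:
  assumes "M m N0 < n"
  obtains N where "N0 \<le> N" "M m N < n" "n \<le> M m (Suc N)"
proof -
  define K where "K = (LEAST K. n \<le> M m K)"
  have K: "n \<le> M m K" unfolding K_def using less_M[of n] by (intro LeastI[of "\<lambda>K. n \<le> M m K" n]) simp
  have "N0 < K" using K assms M_mono[of K N0] by (meson leD le_less_trans not_le_imp_less order_trans)
  then obtain N where N: "K = Suc N" "N0 \<le> N" by (cases K) auto
  then have "\<not> n \<le> M m N" using not_less_Least[of N "\<lambda>K. n \<le> M m K"] by (simp add: K_def)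
  then show ?thesis using that N K by simp
qed

text \<open>The infimum over \<open>N\<close> of the tail maximal functions has integral zero, hence
  vanishes almost everywhere, and there the martingale is Cauchy. The estimate follows by letting
  \<open>k\<close> tend to infinity in \<open>tail_max_ge\<close> and integrating.\<close>

lemma martingale_limit:
  assumes f: "vil_martingale m f" and p: "0 < p" and lim: "tail_int p f \<longlonglongrightarrow> 0"
  obtains g where "g \<in> borel_measurable (vil_mu m)"
    "\<And>N. (\<integral>\<^sup>+ x. ennreal (norm (f N x - g x) powr p) \<partial>vil_mu m) \<le> tail_int p f N"
proof
  note [measurable] = f measurable_tail_max[OF f]
  \<comment> \<open>Where the sequence diverges \<open>lim\<close> has an unspecified value; this
    concerns a null set only.\<close>
  define g where "g x = lim (\<lambda>k. f k x)" for x
  show "g \<in> borel_measurable (vil_mu m)" unfolding g_def by measurable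
  have "(\<integral>\<^sup>+ x. (INF N. tail_max p f N x) \<partial>vil_mu m) \<le> tail_int p f N" for N
    unfolding tail_int_def by (intro nn_integral_mono INF_lower) simp
  then have "(\<integral>\<^sup>+ x. (INF N. tail_max p f N x) \<partial>vil_mu m) \<le> 0"
    by (intro LIMSEQ_le_const[OF lim]) auto
  then have "AE x in vil_mu m. (INF N. tail_max p f N x) = 0"
    by (subst (asm) le_zero_eq, subst (asm) nn_integral_0_iff_AE) auto
  then have conv: "AE x in vil_mu m. (\<lambda>k. f k x) \<longlonglongrightarrow> g x"
  proof eventually_elim
    case (elim x)
    have "Cauchy (\<lambda>k. f k x)"
    proof (rule metric_CauchyI)
      fix e :: real assume e: "0 < e"
      then have "(INF N. tail_max p f N x) < ennreal ((e / 2) powr p)" using elim by simp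
      then obtain N where N: "tail_max p f N x < ennreal ((e / 2) powr p)"
        by (auto simp: INF_less_iff)
      have *: "dist (f k x) (f N x) < e / 2" if "N \<le> k" for k
      proof -
        have "ennreal (norm (f k x - f N x) powr p) < ennreal ((e / 2) powr p)"
          using tail_max_ge[OF that] N by (rule le_less_trans)
        then have "norm (f k x - f N x) powr p < (e / 2) powr p" by (simp add: ennreal_less_iff)
        then show ?thesis
          using p e by (metis dist_norm less_eq_real_def half_gt_zero not_less powr_mono2)
      qed
      have "dist (f k x) (f l x) < e" if "N \<le> k" "N \<le> l" for k l
        using dist_triangle_half_l[of "f k x" "f N x" e "f l x"] *[OF that(1)] *[OF that(2)] by simp
      then show "\<exists>N. \<forall>k\<ge>N. \<forall>l\<ge>N. dist (f k x) (f l x) < e" by blast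
    qed
    then show ?case by (simp add: g_def Cauchy_convergent_iff convergent_LIMSEQ_iff)
  qed
  show "(\<integral>\<^sup>+ x. ennreal (norm (f N x - g x) powr p) \<partial>vil_mu m) \<le> tail_int p f N" for N
    unfolding tail_int_def
  proof (rule nn_integral_mono_AE)
    show "AE x in vil_mu m. ennreal (norm (f N x - g x) powr p) \<le> tail_max p f N x"
      using conv
    proof eventually_elim
      case (elim x)
      have "(\<lambda>k. ennreal (norm (f N x - f k x) powr p)) \<longlonglongrightarrow> ennreal (norm (f N x - g x) powr p)"
        using p by (intro tendsto_ennrealI tendsto_powr' tendsto_norm tendsto_diff elim tendsto_const) auto
      then show ?case
        by (rule LIMSEQ_le_const2) (metis tail_max_ge norm_minus_commute)
    qed
  qed
qed

section \<open>The modulus condition and convergence of the Fejer means\<close>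

lemma tail_tendsto_0:
  assumes Hp: "in_Hp m p f" and p: "0 < p" "p \<le> 1 / 2"
    and omega: "(\<lambda>N. modulus m p f N) \<in>
       o(\<lambda>N. 1 / (real (M m N) powr (1/p - 2) * real N ^ (2 * nat \<lfloor>1/2 + p\<rfloor>)))"
  shows "(\<lambda>N. real (M m N) powr (1 - 2 * p) * (real N ^ (2 * nat \<lfloor>1/2 + p\<rfloor>)) powr p
            * enn2real (tail_int p f N)) \<longlonglongrightarrow> 0"
proof -
  define c where "c N = real (M m N) powr (1/p - 2) * real N ^ (2 * nat \<lfloor>1/2 + p\<rfloor>)" for N
  have w: "0 \<le> modulus m p f N" for N by (simp add: modulus_def Hp_norm_def)
  have "(\<lambda>N. modulus m p f N / (1 / c N)) \<longlonglongrightarrow> 0"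
    using smalloD_tendsto[OF omega] by (simp add: c_def)
  then have "(\<lambda>N. c N * modulus m p f N) \<longlonglongrightarrow> 0" by (simp add: mult.commute)
  then have "(\<lambda>N. (c N * modulus m p f N) powr p) \<longlonglongrightarrow> 0"
    using p w by (intro tendsto_zero_powrI[OF _ tendsto_const]) (auto simp: c_def)
  moreover have "(c N * modulus m p f N) powr p
      = real (M m N) powr (1 - 2 * p) * (real N ^ (2 * nat \<lfloor>1/2 + p\<rfloor>)) powr p * enn2real (tail_int p f N)" for N
  proof -
    \<comment> \<open>Taking \<open>p\<close>-th powers turns the exponent of the hypothesis into
      the one of the kernel estimate.\<close>
    have "(1/p - 2) * p = 1 - 2 * p" using p by (simp add: field_simps)
    then show ?thesis
      using w by (simp add: c_def powr_mult powr_powr modulus_powr[OF Hp p(1)])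
  qed
  ultimately show ?thesis by simp
qed

text \<open>All three sequences are eventually dominated by a multiple of the null sequence of
  \<open>tail_tendsto_0\<close>: the first two because the weights \<open>R N\<close> and
  \<open>L N\<close> are at least 1, the third because \<open>level_sum_le\<close> and the
  boundedness of \<open>m\<close> reduce \<open>increment_bound\<close> to these weights.\<close>

lemma increments_tendsto_0:
  assumes Hp: "in_Hp m p f" and p: "0 < p" "p \<le> 1 / 2"
    and omega: "(\<lambda>N. modulus m p f N) \<in>
       o(\<lambda>N. 1 / (real (M m N) powr (1/p - 2) * real N ^ (2 * nat \<lfloor>1/2 + p\<rfloor>)))"
  shows "(\<lambda>N. enn2real (tail_int p f N)) \<longlonglongrightarrow> 0" "increment p f \<longlonglongrightarrow> 0" "increment_bound p f \<longlonglongrightarrow> 0"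
proof -
  have f: "vil_martingale m f" using Hp by (simp add: in_Hp_def)
  define w where "w N = enn2real (tail_int p f N)" for N
  define L where "L N = (real N ^ (2 * nat \<lfloor>1/2 + p\<rfloor>)) powr p" for N
  define R where "R N = real (M m N) powr (1 - 2 * p)" for N
  have lim: "(\<lambda>N. R N * L N * w N) \<longlonglongrightarrow> 0"
    using tail_tendsto_0[OF assms] by (simp add: w_def L_def R_def)
  have w0: "0 \<le> w N" for N by (simp add: w_def)
  have R1: "1 \<le> R N" for N
    unfolding R_def using M_pos[of N] p by (intro ge_one_powr_ge_zero) auto
  \<comment> \<open>The index 0 is excluded because \<open>L 0 = 0\<close> when
    \<open>p = 1 / 2\<close>.\<close>
  have L1: "1 \<le> L N" if "1 \<le> N" for N
    unfolding L_def using that p by (intro ge_one_powr_ge_zero one_le_power) auto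
  have inc: "increment p f N \<le> w N" for N
  proof -
    have "tail_int p f N = ennreal (w N)"
      using tail_int_finite[OF Hp p(1), of N] p by (simp add: w_def)
    then show ?thesis using increment_le_tail_int[OF f, of p N] w0 by simp
  qed
  have "w N \<le> R N * L N * w N" if "1 \<le> N" for N
    using mult_mono[OF R1[of N] L1[OF that]] R1[of N] w0[of N] mult_right_mono[of 1 "R N * L N" "w N"]
    by simp
  then show w: "(\<lambda>N. enn2real (tail_int p f N)) \<longlonglongrightarrow> 0"
    unfolding w_def [symmetric] using w0
    by (intro tendsto_sandwich[OF _ _ tendsto_const lim] eventually_sequentiallyI[of 1]) auto
  show "increment p f \<longlonglongrightarrow> 0"
    by (rule tendsto_sandwich[OF _ _ tendsto_const w]) (auto simp: increment_nonneg inc simp flip: w_def)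
  obtain K where K: "0 \<le> K" "\<And>N. 1 \<le> N \<Longrightarrow> level_sum p (Suc N) \<le> K * L N"
    using level_sum_le[OF p] unfolding L_def by blast
  define C where "C = real B powr p * fejer_const p"
  have C: "0 \<le> C" using fejer_const_nonneg[of p] p by (simp add: C_def)
  have bound: "increment_bound p f N \<le> C * (real B powr (1 - 2 * p) * K) * (R N * L N * w N)" if "1 \<le> N" for N
  proof -
    have "real (M m (Suc N)) powr (1 - 2 * p) \<le> (real B * real (M m N)) powr (1 - 2 * p)"
      using p m_le[of N] by (intro powr_mono2) (auto simp: M_Suc mult_right_mono)
    then have RS: "real (M m (Suc N)) powr (1 - 2 * p) \<le> real B powr (1 - 2 * p) * R N"
      by (simp add: R_def powr_mult)
    have "increment_bound p f N = C * (real (M m (Suc N)) powr (1 - 2 * p) * level_sum p (Suc N) * increment p f N)"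
      by (simp add: increment_bound_def C_def)
    also have "\<dots> \<le> C * ((real B powr (1 - 2 * p) * R N) * (K * L N) * w N)"
      using K(1) L1[OF that] R1[of N]
      by (intro mult_left_mono[OF _ C] mult_mono RS K(2)[OF that] inc)
        (auto simp: increment_nonneg level_sum_nonneg)
    finally show ?thesis by (simp add: mult_ac)
  qed
  have nonneg: "0 \<le> increment_bound p f N" for N
    unfolding increment_bound_def C_def [symmetric]
    using C by (simp add: increment_nonneg level_sum_nonneg)
  have lim': "(\<lambda>N. C * (real B powr (1 - 2 * p) * K) * (R N * L N * w N)) \<longlonglongrightarrow> 0"
    by (rule tendsto_mult_right_zero[OF lim])
  show "increment_bound p f \<longlonglongrightarrow> 0"
    by (rule tendsto_sandwich[OF _ eventually_sequentiallyI[of 1, OF bound] tendsto_const lim'])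
      (simp_all add: nonneg)
qed

text \<open>For \<open>n\<close> in the block above \<open>M m N\<close> the comparison passes
  through \<open>f N\<close>: \<open>fejer_dist_le\<close> controls the Fejer mean against
  \<open>f N\<close>, the tail integral controls \<open>f N\<close> against \<open>g\<close>. The
  bound \<open>b N\<close> depends on the block alone, and \<open>N\<close> grows with
  \<open>n\<close>.\<close>

lemma fejer_convergence:
  assumes Hp: "in_Hp m p f" and p: "0 < p" "p \<le> 1 / 2"
    and omega: "(\<lambda>N. modulus m p f N) \<in>
       o(\<lambda>N. 1 / (real (M m N) powr (1/p - 2) * real N ^ (2 * nat \<lfloor>1/2 + p\<rfloor>)))"
  shows "\<exists>g \<in> borel_measurable (vil_mu m).
           ((\<lambda>k. \<integral>\<^sup>+ x. ennreal (cmod (f k x - g x) powr p) \<partial>vil_mu m) \<longlonglongrightarrow> 0) \<and>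
           ((\<lambda>n. \<integral>\<^sup>+ x. ennreal (cmod (fejer m f n x - g x) powr p) \<partial>vil_mu m) \<longlonglongrightarrow> 0)"
proof -
  have f: "vil_martingale m f" using Hp by (simp add: in_Hp_def)
  note [measurable] = f
  have p1: "p \<le> 1" using p by simp
  define w where "w N = enn2real (tail_int p f N)" for N
  have tw: "tail_int p f = (\<lambda>N. ennreal (w N))"
    using tail_int_finite[OF Hp p(1) p1] by (auto simp: w_def)
  have w0: "0 \<le> w N" for N by (simp add: w_def)
  note lims = increments_tendsto_0[OF assms, folded w_def]
  have "tail_int p f \<longlonglongrightarrow> 0"
    unfolding tw using tendsto_ennrealI[OF lims(1)] by simp
  from martingale_limit[OF f p(1) this] obtain g where
    g [measurable]: "g \<in> borel_measurable (vil_mu m)" and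
    fg: "\<And>N. (\<integral>\<^sup>+ x. ennreal (norm (f N x - g x) powr p) \<partial>vil_mu m) \<le> ennreal (w N)"
    unfolding tw by blast
  define b where "b N = increment_bound p f N + fejer_defect p f N + w N" for N
  have "b \<longlonglongrightarrow> 0 + 0 + 0"
    unfolding b_def
    by (intro tendsto_add lims(1,3) fejer_defect_tendsto_0[OF f p(1) p1 lims(3,2)])
  then have lim_b: "(\<lambda>N. ennreal (b N)) \<longlonglongrightarrow> 0" using tendsto_ennrealI[of b 0] by simp
  have main: "(\<integral>\<^sup>+ x. ennreal (norm (fejer m f n x - g x) powr p) \<partial>vil_mu m) \<le> ennreal (b N)"
    if n: "M m N < n" "n \<le> M m (Suc N)" for n N
  proof -
    have dep: "depends (Suc N) (\<lambda>x. norm (fejer m f n x - f N x) powr p)"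
      by (rule depends_comp2[OF depends_fejer[OF f n(2)] depends_mono[OF martingale_depends[OF f]]]) simp
    have meas: "(\<lambda>x. ennreal (norm (fejer m f n x - f N x) powr p)) \<in> borel_measurable (vil_mu m)"
      by (rule measurable_compose[OF measurable_depends[OF dep] measurable_ennreal])
    have "(\<integral>\<^sup>+ x. ennreal (norm (fejer m f n x - g x) powr p) \<partial>vil_mu m)
        \<le> (\<integral>\<^sup>+ x. ennreal (norm (fejer m f n x - f N x) powr p) + ennreal (norm (f N x - g x) powr p) \<partial>vil_mu m)"
    proof (rule nn_integral_mono)
      fix x
      have "norm (fejer m f n x - g x) powr p \<le> norm (fejer m f n x - f N x) powr p + norm (f N x - g x) powr p"
        using norm_add_powr_le[OF p(1) p1, of "fejer m f n x - f N x" "f N x - g x"] by simp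
      then show "ennreal (norm (fejer m f n x - g x) powr p)
          \<le> ennreal (norm (fejer m f n x - f N x) powr p) + ennreal (norm (f N x - g x) powr p)"
        by (simp flip: ennreal_plus)
    qed
    also have "\<dots> = ennreal (avg (Suc N) (\<lambda>x. norm (fejer m f n x - f N x) powr p))
        + (\<integral>\<^sup>+ x. ennreal (norm (f N x - g x) powr p) \<partial>vil_mu m)"
      by (subst nn_integral_add[OF meas]) (simp_all add: nn_integral_depends[OF dep])
    also have "\<dots> \<le> ennreal (increment_bound p f N + fejer_defect p f N) + ennreal (w N)"
    proof (intro add_mono fg ennreal_leI)
      \<comment> \<open>Bounding the factor by 1 makes the estimate uniform over the block.\<close>
      have "(real (M m N) / real n) powr p \<le> 1" using n p by (intro powr_le1) auto
      then have "(real (M m N) / real n) powr p * fejer_defect p f N \<le> fejer_defect p f N"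
        using mult_right_mono[of _ 1 "fejer_defect p f N"] fejer_defect_nonneg by simp
      then show "avg (Suc N) (\<lambda>x. norm (fejer m f n x - f N x) powr p)
          \<le> increment_bound p f N + fejer_defect p f N"
        using fejer_dist_le[OF f p(1) p1 less_imp_le[OF n(1)] n(2)] by linarith
    qed
    also have "\<dots> = ennreal (b N)"
    proof -
      have "0 \<le> increment_bound p f N" unfolding increment_bound_def
        using fejer_const_nonneg[OF p(1) p1] by (simp add: increment_nonneg level_sum_nonneg)
      then show ?thesis using w0 fejer_defect_nonneg[of p f N]
        by (simp add: b_def flip: ennreal_plus)
    qed
    finally show ?thesis .
  qed
  have "(\<lambda>n. \<integral>\<^sup>+ x. ennreal (norm (fejer m f n x - g x) powr p) \<partial>vil_mu m) \<longlonglongrightarrow> 0"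
  proof (rule order_tendstoI)
    fix a :: ennreal assume "0 < a"
    then obtain N0 where N0: "\<And>N. N0 \<le> N \<Longrightarrow> ennreal (b N) < a"
      using order_tendstoD(2)[OF lim_b] by (auto simp: eventually_sequentially)
    show "\<forall>\<^sub>F n in sequentially. (\<integral>\<^sup>+ x. ennreal (norm (fejer m f n x - g x) powr p) \<partial>vil_mu m) < a"
    proof (rule eventually_sequentiallyI[of "Suc (M m N0)"])
      fix n assume "Suc (M m N0) \<le> n"
      then have "M m N0 < n" by simp
      then obtain N where "N0 \<le> N" "M m N < n" "n \<le> M m (Suc N)" by (rule ex_level)
      then show "(\<integral>\<^sup>+ x. ennreal (norm (fejer m f n x - g x) powr p) \<partial>vil_mu m) < a"
        using main[of N n] N0[of N] by (meson le_less_trans)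
    qed
  qed simp
  moreover have "(\<lambda>k. \<integral>\<^sup>+ x. ennreal (norm (f k x - g x) powr p) \<partial>vil_mu m) \<longlonglongrightarrow> 0"
    using tendsto_ennrealI[OF lims(1)]
    by (intro tendsto_sandwich[OF _ always_eventually[OF allI[OF fg]] tendsto_const]) auto
  ultimately show ?thesis using g by blast
qed

end

text \<open>\<open>g\<close> is the function that the martingale stands for in the norm: the first
  limit determines it up to null sets as the \<open>L_p\<close> limit of \<open>f k\<close>, and the
  second is the asserted convergence to it.\<close>

theorem theorem1:
  fixes m :: "nat \<Rightarrow> nat" and p :: real and f :: "nat \<Rightarrow> (nat \<Rightarrow> nat) \<Rightarrow> complex"
  assumes m_ge: "\<And>k. m k \<ge> 2"
    and m_bdd: "\<exists>B. \<forall>k. m k \<le> B"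
    and p_pos: "0 < p" and p_le: "p \<le> 1/2"
    and f_Hp: "in_Hp m p f"
    and omega: "(\<lambda>N. modulus m p f N) \<in>
       o(\<lambda>N. 1 / (real (M m N) powr (1/p - 2) * real N ^ (2 * nat \<lfloor>1/2 + p\<rfloor>)))"
  shows "\<exists>g \<in> borel_measurable (vil_mu m).
           ((\<lambda>k. \<integral>\<^sup>+ x. ennreal (cmod (f k x - g x) powr p) \<partial>vil_mu m) \<longlonglongrightarrow> 0) \<and>
           ((\<lambda>n. \<integral>\<^sup>+ x. ennreal (cmod (fejer m f n x - g x) powr p) \<partial>vil_mu m) \<longlonglongrightarrow> 0)"
proof -
  obtain B where "\<And>k. m k \<le> B" using m_bdd by blast
  then interpret bounded_vilenkin m B using m_ge by unfold_locales
  show ?thesis by (rule fejer_convergence[OF f_Hp p_pos p_le omega])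
qed

end
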